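(* Let $\mathcal{F}$ be a set of $c$-colored graphs such that every $F\in\mathcal{F}$ is color diverse and such that it can be decided in polynomial time whether a given edge-colored graph contains some $F\in\mathcal{F}$ as an induced subgraph. Then \textsc{$\mathcal{F}$-Deletion} can be solved in $2^{\gamma^2}\cdot n^{\mathcal{O}(1)}$ time, where $n$ is the number of vertices and $\gamma$ is the colored neighborhood diversity of the input graph.
   Context: An edge-colored ($c$-colored) graph is a simple graph $G=(V,E)$ with $E=E_1\sqcup\dots\sqcup E_c$ (non-empty color classes). For a vertex $v$ and color $i$, $N^i(v)=\{u:\{u,v\}\in E_i\}$ and $N^i[v]=N^i(v)\cup\{v\}$. Two vertices $u,v$ satisfy $u\sim v$ if either (a) $N^i[u]=N^i[v]$ for some color $i$ and $N^j(u)=N^j(v)$ for every other color $j\neq i$, or (b) $N^j(u)=N^j(v)$ for every color $j$. This is an equivalence relation; its classes are the colored neighborhood classes, and the colored neighborhood diversity $\gamma(G)$ is their number. A graph $F$ is color diverse if every colored neighborhood class of $F$ has size one. For edge-colored graphs, $G$ contains $F$ as an induced subgraph if some $G[V']$ is isomorphic to $F$ via a bijection preserving adjacency and edge colors; $G$ is $F$-free otherwise. \textsc{$\mathcal{F}$-Deletion}: given an edge-colored graph $G$ and an integer $k$, decide whether there is a set $S$ of at most $k$ edges such that $G-S$ is $F$-free for every $F\in\mathcal{F}$. *)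

theory Defs
  imports Main
begin

section \<open>Edge-colored graphs\<close>

text \<open>The colors of \<open>G\<close> are \<open>1, \<dots>, ncolors G\<close>, and \<open>cedges G i\<close> is the color class \<open>E\<^sub>i\<close>.\<close>

record 'v ecgraph =
  verts :: "'v set"
  ncolors :: nat
  cedges :: "nat \<Rightarrow> 'v set set"

definition colors :: "'v ecgraph \<Rightarrow> nat set" where
  "colors G = {1..ncolors G}"

definition edges :: "'v ecgraph \<Rightarrow> 'v set set" where
  "edges G = (\<Union>i\<in>colors G. cedges G i)"

definition edge_colored :: "'v ecgraph \<Rightarrow> bool" where
  "edge_colored G \<longleftrightarrow>
     finite (verts G) \<and>
     (\<forall>i\<in>colors G. cedges G i \<noteq> {}) \<and>
     (\<forall>i\<in>colors G. \<forall>e\<in>cedges G i. e \<subseteq> verts G \<and> card e = 2) \<and>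
     (\<forall>i\<in>colors G. \<forall>j\<in>colors G. i \<noteq> j \<longrightarrow> cedges G i \<inter> cedges G j = {}) \<and>
     (\<forall>i. i \<notin> colors G \<longrightarrow> cedges G i = {})"

definition c_colored :: "nat \<Rightarrow> 'v ecgraph \<Rightarrow> bool" where
  "c_colored c G \<longleftrightarrow> edge_colored G \<and> ncolors G = c"

definition nbh :: "'v ecgraph \<Rightarrow> nat \<Rightarrow> 'v \<Rightarrow> 'v set" where
  "nbh G i v = {u. {u, v} \<in> cedges G i}"

definition closed_nbh :: "'v ecgraph \<Rightarrow> nat \<Rightarrow> 'v \<Rightarrow> 'v set" where
  "closed_nbh G i v = nbh G i v \<union> {v}"

definition nbh_rel :: "'v ecgraph \<Rightarrow> ('v \<times> 'v) set" where
  "nbh_rel G = {(u, v). u \<in> verts G \<and> v \<in> verts G \<and>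
     ((\<exists>i\<in>colors G. closed_nbh G i u = closed_nbh G i v \<and>
                     (\<forall>j\<in>colors G. j \<noteq> i \<longrightarrow> nbh G j u = nbh G j v)) \<or>
      (\<forall>j\<in>colors G. nbh G j u = nbh G j v))}"

definition nbh_classes :: "'v ecgraph \<Rightarrow> 'v set set" where
  "nbh_classes G = verts G // nbh_rel G"

definition nbh_diversity :: "'v ecgraph \<Rightarrow> nat" where
  "nbh_diversity G = card (nbh_classes G)"

definition color_diverse :: "'v ecgraph \<Rightarrow> bool" where
  "color_diverse G \<longleftrightarrow> (\<forall>C\<in>nbh_classes G. card C = 1)"

text \<open>Induced subgraphs and edge deletions keep the number of colors of \<open>G\<close>,
  so some of their color classes may be empty.\<close>

definition induced :: "'v ecgraph \<Rightarrow> 'v set \<Rightarrow> 'v ecgraph" where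
  "induced G W = \<lparr>verts = W, ncolors = ncolors G,
                  cedges = (\<lambda>i. {e \<in> cedges G i. e \<subseteq> W})\<rparr>"

definition delete_edges :: "'v ecgraph \<Rightarrow> 'v set set \<Rightarrow> 'v ecgraph" where
  "delete_edges G S = \<lparr>verts = verts G, ncolors = ncolors G,
                       cedges = (\<lambda>i. cedges G i - S)\<rparr>"

definition isomorphic :: "'v ecgraph \<Rightarrow> 'w ecgraph \<Rightarrow> bool" where
  "isomorphic G H \<longleftrightarrow> (\<exists>f. bij_betw f (verts G) (verts H) \<and>
     (\<forall>u\<in>verts G. \<forall>v\<in>verts G. \<forall>i. {u, v} \<in> cedges G i \<longleftrightarrow> {f u, f v} \<in> cedges H i))"

definition contains_induced :: "'v ecgraph \<Rightarrow> 'w ecgraph \<Rightarrow> bool" where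
  "contains_induced G F \<longleftrightarrow> (\<exists>W\<subseteq>verts G. isomorphic (induced G W) F)"

definition deletion_yes :: "'w ecgraph set \<Rightarrow> ('v ecgraph \<times> int) set" where
  "deletion_yes \<F> = {(G, k). \<exists>S\<subseteq>edges G. int (card S) \<le> k \<and>
     (\<forall>F\<in>\<F>. \<not> contains_induced (delete_edges G S) F)}"


section \<open>Model of computation\<close>

text \<open>Jones' language WHILE over binary trees, with his time measure (N. D. Jones,
  Computability and Complexity from a Programming Perspective, MIT Press 1997).
  Every single operation is implemented by a constant number of pointer operations, so a RAM
  simulates a program with constant-factor overhead; polynomial time agrees with that
  of Turing machines. There is deliberately no unit-cost comparison of trees:
  a program can only test whether a tree is \<open>NIL\<close>.\<close>

datatype tree = NIL | CONS tree tree

fun head :: "tree \<Rightarrow> tree" where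
  "head NIL = NIL"
| "head (CONS a b) = a"

fun tail :: "tree \<Rightarrow> tree" where
  "tail NIL = NIL"
| "tail (CONS a b) = b"

fun tree_size :: "tree \<Rightarrow> nat" where
  "tree_size NIL = 1"
| "tree_size (CONS a b) = tree_size a + tree_size b + 1"

datatype expr = Var nat | Nil_e | Cons_e expr expr | Hd_e expr | Tl_e expr

type_synonym store = "nat \<Rightarrow> tree"

fun expr_val :: "expr \<Rightarrow> store \<Rightarrow> tree" where
  "expr_val (Var x) s = s x"
| "expr_val Nil_e s = NIL"
| "expr_val (Cons_e e f) s = CONS (expr_val e s) (expr_val f s)"
| "expr_val (Hd_e e) s = head (expr_val e s)"
| "expr_val (Tl_e e) s = tail (expr_val e s)"

fun expr_time :: "expr \<Rightarrow> nat" where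
  "expr_time (Var x) = 1"
| "expr_time Nil_e = 1"
| "expr_time (Cons_e e f) = 1 + expr_time e + expr_time f"
| "expr_time (Hd_e e) = 1 + expr_time e"
| "expr_time (Tl_e e) = 1 + expr_time e"

datatype com = Assign nat expr | Seq com com | If expr com com | While expr com

text \<open>\<open>exec p s t s'\<close>: started in store \<open>s\<close>, the program \<open>p\<close> halts in store \<open>s'\<close>
  after exactly \<open>t\<close> steps.\<close>

inductive exec :: "com \<Rightarrow> store \<Rightarrow> nat \<Rightarrow> store \<Rightarrow> bool" where
  Assign: "exec (Assign x e) s (1 + expr_time e) (s(x := expr_val e s))"
| Seq: "exec p s t s' \<Longrightarrow> exec q s' t' s'' \<Longrightarrow> exec (Seq p q) s (t + t') s''"
| IfTrue: "expr_val e s \<noteq> NIL \<Longrightarrow> exec p s t s' \<Longrightarrow>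
    exec (If e p q) s (1 + expr_time e + t) s'"
| IfFalse: "expr_val e s = NIL \<Longrightarrow> exec q s t s' \<Longrightarrow>
    exec (If e p q) s (1 + expr_time e + t) s'"
| WhileFalse: "expr_val e s = NIL \<Longrightarrow> exec (While e p) s (1 + expr_time e) s"
| WhileTrue: "expr_val e s \<noteq> NIL \<Longrightarrow> exec p s t s' \<Longrightarrow> exec (While e p) s' t' s'' \<Longrightarrow>
    exec (While e p) s (1 + expr_time e + t + t') s''"

text \<open>Variable 0 holds the input at the start and the answer at the end (\<open>NIL\<close> means no).\<close>

definition init_store :: "tree \<Rightarrow> store" where
  "init_store d = (\<lambda>x. NIL)(0 := d)"

text \<open>The program decides the problem with instances \<open>A\<close> and yes-set \<open>Y\<close>;
  nothing is required of it on inputs that do not encode a member of \<open>A\<close>.\<close>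

definition decides_in_time ::
  "com \<Rightarrow> ('x \<Rightarrow> tree) \<Rightarrow> 'x set \<Rightarrow> 'x set \<Rightarrow> ('x \<Rightarrow> nat) \<Rightarrow> bool" where
  "decides_in_time p enc A Y T \<longleftrightarrow>
     (\<forall>x\<in>A. \<exists>t s. exec p (init_store (enc x)) t s \<and> t \<le> T x \<and> (s 0 \<noteq> NIL \<longleftrightarrow> x \<in> Y))"

definition poly_time_decidable :: "('x \<Rightarrow> tree) \<Rightarrow> 'x set \<Rightarrow> 'x set \<Rightarrow> bool" where
  "poly_time_decidable enc A Y \<longleftrightarrow>
     (\<exists>p a d. decides_in_time p enc A Y (\<lambda>x. a * tree_size (enc x) ^ d))"


section \<open>Instances and their encoding\<close>

definition input_graphs :: "nat ecgraph set" where
  "input_graphs = {G. edge_colored G \<and> verts G = {..<card (verts G)}}"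

fun enc_nat :: "nat \<Rightarrow> tree" where
  "enc_nat 0 = NIL"
| "enc_nat (Suc n) = CONS NIL (enc_nat n)"

text \<open>Sign and absolute value.\<close>

definition enc_int :: "int \<Rightarrow> tree" where
  "enc_int k = CONS (enc_nat (if k < 0 then 1 else 0)) (enc_nat (nat \<bar>k\<bar>))"

fun enc_list :: "tree list \<Rightarrow> tree" where
  "enc_list [] = NIL"
| "enc_list (x # xs) = CONS x (enc_list xs)"

definition pair_color :: "'v ecgraph \<Rightarrow> 'v \<Rightarrow> 'v \<Rightarrow> nat" where
  "pair_color G u v = (if {u, v} \<in> edges G then (THE i. {u, v} \<in> cedges G i) else 0)"

text \<open>Adjacency matrix whose entries are the colors, with 0 for non-adjacent pairs.
  Since color classes are non-empty, the number of colors is at most the number of edges,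
  so unary entries keep the size polynomial in the number of vertices.\<close>

definition enc_graph :: "nat ecgraph \<Rightarrow> tree" where
  "enc_graph G =
     (let vs = [0..<card (verts G)] in
      enc_list (map (\<lambda>u. enc_list (map (\<lambda>v. enc_nat (pair_color G u v)) vs)) vs))"

definition enc_instance :: "nat ecgraph \<times> int \<Rightarrow> tree" where
  "enc_instance = (\<lambda>(G, k). CONS (enc_graph G) (enc_int k))"

end

theory Submission imports Defs begin

text \<open>There is an optimal solution that treats all vertices of a colored neighborhood class alike:
  given a solution, let every vertex of a class imitate a vertex of that class incident with the fewest
  deleted edges leaving the class, and keep all edges inside the class. This does not increase the number
  of deleted edges. After the change the class still consists of twins, so a copy of a color diverse
  graph uses at most one of its vertices, and replacing it by the imitated vertex yields a copy that
  was already present before. Hence it suffices to try, for every set of pairs of classes, to delete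
  all edges between the two classes of each pair; there are \<open>2\<close> to the power \<open>\<gamma>\<^sup>2\<close> sets of ordered pairs.\<close>

section \<open>Polynomial-time subroutines\<close>

text \<open>The machine model shapes most of the development. Programs work on trees, have no
  procedures and cannot compare trees, so polynomial time is obtained from closure rules for
  functions on trees, each producing a program together with a time bound and an output-size bound.
  The decider for \<open>\<F>\<close> is a foreign program: it expects every variable except the
  input to be \<open>NIL\<close>, and it is specified only on encodings of legal graphs, which is
  why computability is stated relative to a set of inputs. The exponential factor comes from a
  single loop, driven by a binary counter with one bit for each ordered pair of class
  representatives. The state of that loop never exceeds a constant multiple of the size of the first
  state, so each round costs only a polynomial in the number of vertices. Every counter value
  describes a genuine set of edges, whatever its bits for equal or reversed pairs are. Hence
  soundness needs no uniformity at all; uniform solutions are what makes the enumeration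
  complete.\<close>

definition poly_bounded :: "(nat \<Rightarrow> nat) \<Rightarrow> bool" where
  "poly_bounded B \<longleftrightarrow> mono B \<and> (\<exists>a d. \<forall>m. B m \<le> a * (m + 1) ^ d)"

lemma poly_boundedI: "mono B \<Longrightarrow> (\<And>m. B m \<le> a * (m + 1) ^ d) \<Longrightarrow> poly_bounded B"
  unfolding poly_bounded_def by blast

lemma poly_bounded_const: "poly_bounded (\<lambda>m. k)"
  by (rule poly_boundedI[of _ k 0]) (auto simp: mono_def)

lemma poly_bounded_id: "poly_bounded (\<lambda>m. m)"
  by (rule poly_boundedI[of _ 1 1]) (auto simp: mono_def)

text \<open>The base \<open>m + 1\<close> is positive, so both exponents can be raised to their
  sum.\<close>

lemma poly_bounded_add:
  assumes "poly_bounded B" "poly_bounded B'"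
  shows "poly_bounded (\<lambda>m. B m + B' m)"
proof -
  obtain a d a' d' where le: "\<And>m. B m \<le> a * (m + 1) ^ d" "\<And>m. B' m \<le> a' * (m + 1) ^ d'"
    using assms unfolding poly_bounded_def by blast
  show ?thesis
  proof (rule poly_boundedI[of _ "a + a'" "d + d'"])
    show "mono (\<lambda>m. B m + B' m)"
      using assms by (auto simp: poly_bounded_def mono_def intro: add_mono)
    fix m :: nat
    have "(m + 1) ^ d \<le> (m + 1) ^ (d + d')" by (intro power_increasing) auto
    moreover have "(m + 1) ^ d' \<le> (m + 1) ^ (d + d')" by (intro power_increasing) auto
    ultimately have "a * (m + 1) ^ d + a' * (m + 1) ^ d' \<le> a * (m + 1) ^ (d + d') + a' * (m + 1) ^ (d + d')"
      by (intro add_mono mult_le_mono2)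
    then show "B m + B' m \<le> (a + a') * (m + 1) ^ (d + d')"
      using le[of m] by (simp add: algebra_simps)
  qed
qed

lemma poly_bounded_mult:
  assumes "poly_bounded B" "poly_bounded B'"
  shows "poly_bounded (\<lambda>m. B m * B' m)"
proof -
  obtain a d a' d' where le: "\<And>m. B m \<le> a * (m + 1) ^ d" "\<And>m. B' m \<le> a' * (m + 1) ^ d'"
    using assms unfolding poly_bounded_def by blast
  show ?thesis
  proof (rule poly_boundedI[of _ "a * a'" "d + d'"])
    show "mono (\<lambda>m. B m * B' m)"
      using assms by (auto simp: poly_bounded_def mono_def intro: mult_mono)
    show "B m * B' m \<le> a * a' * (m + 1) ^ (d + d')" for m
      using mult_mono[OF le[of m]] by (simp add: power_add algebra_simps)
  qed
qed

lemma poly_bounded_comp: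
  assumes "poly_bounded B" "poly_bounded B'"
  shows "poly_bounded (\<lambda>m. B (B' m))"
proof -
  obtain a d a' d' where le: "\<And>m. B m \<le> a * (m + 1) ^ d" "\<And>m. B' m \<le> a' * (m + 1) ^ d'"
    using assms unfolding poly_bounded_def by blast
  show ?thesis
  proof (rule poly_boundedI[of _ "a * (a' + 1) ^ d" "d' * d"])
    show "mono (\<lambda>m. B (B' m))"
      using assms by (auto simp: poly_bounded_def mono_def)
    fix m
    \<comment> \<open>The summand 1 is absorbed by a further copy of \<open>(m + 1) ^ d'\<close>,
      which is at least 1.\<close>
    have "B' m + 1 \<le> (a' + 1) * (m + 1) ^ d'"
      using add_mono[OF le(2)[of m] one_le_power[of "m + 1" d']] by simp
    then have "(B' m + 1) ^ d \<le> ((a' + 1) * (m + 1) ^ d') ^ d"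
      by (rule power_mono) simp
    then have "a * (B' m + 1) ^ d \<le> a * ((a' + 1) * (m + 1) ^ d') ^ d"
      by (rule mult_le_mono2)
    then show "B (B' m) \<le> a * (a' + 1) ^ d * (m + 1) ^ (d' * d)"
      using le(1)[of "B' m"] unfolding power_mult_distrib power_mult mult.assoc by (rule order_trans[rotated])
  qed
qed

text \<open>This is why monotonicity is built into \<open>poly_bounded\<close>: a bound in the
  actual size of an intermediate tree becomes a bound in an estimate of that size.\<close>

lemma poly_bounded_monoD: "poly_bounded B \<Longrightarrow> m \<le> m' \<Longrightarrow> B m \<le> B m'"
  by (auto simp: poly_bounded_def mono_def)

lemmas poly_bounded_intros =
  poly_bounded_const poly_bounded_id poly_bounded_add poly_bounded_mult

lemma poly_bounded_power: "poly_bounded (\<lambda>m. a * m ^ d)"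
  by (rule poly_boundedI[of _ a d]) (auto simp: mono_def intro!: mult_le_mono2 power_mono)

section \<open>Total correctness with time bounds\<close>

definition runs :: "com \<Rightarrow> store \<Rightarrow> nat \<Rightarrow> (store \<Rightarrow> bool) \<Rightarrow> bool" where
  "runs p s T Q \<longleftrightarrow> (\<exists>t s'. exec p s t s' \<and> t \<le> T \<and> Q s')"

lemma runs_mono: "runs p s T Q \<Longrightarrow> T \<le> T' \<Longrightarrow> (\<And>s'. Q s' \<Longrightarrow> Q' s') \<Longrightarrow> runs p s T' Q'"
  unfolding runs_def by (meson order_trans)

lemma runs_le: "runs p s T Q \<Longrightarrow> T \<le> T' \<Longrightarrow> runs p s T' Q"
  by (rule runs_mono)

lemma runs_Assign: "Q (s(x := expr_val e s)) \<Longrightarrow> runs (Assign x e) s (1 + expr_time e) Q"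
  unfolding runs_def by (blast intro: exec.Assign)

text \<open>The rest of the program sits in the postcondition, so a sequence is processed from left
  to right by repeated rule application, and the time bounds add up on the way.\<close>

lemma runs_Seq: "runs p s T (\<lambda>s'. runs q s' T' Q) \<Longrightarrow> runs (Seq p q) s (T + T') Q"
  unfolding runs_def by (blast intro: exec.Seq add_mono)

lemma runs_If:
  assumes "expr_val e s \<noteq> NIL \<Longrightarrow> runs p s T Q" "expr_val e s = NIL \<Longrightarrow> runs q s T Q"
  shows "runs (If e p q) s (1 + expr_time e + T) Q"
  using assms unfolding runs_def by (meson IfTrue IfFalse add_left_mono)

text \<open>The invariant is indexed by the round, which fixes the number of rounds to exactly
  \<open>m\<close>. The factor \<open>m + 1\<close> accounts for the final evaluation of the
  guard.\<close>

lemma runs_While: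
  assumes "I 0 s"
    and "\<And>i s. i < m \<Longrightarrow> I i s \<Longrightarrow> expr_val e s \<noteq> NIL \<and> runs p s T (I (Suc i))"
    and "\<And>s. I m s \<Longrightarrow> expr_val e s = NIL"
  shows "runs (While e p) s ((m + 1) * (1 + expr_time e + T)) (I m)"
  using assms
proof (induction m arbitrary: I s)
  case 0
  then have "exec (While e p) s (1 + expr_time e) s" by (intro WhileFalse) blast
  then show ?case using 0 unfolding runs_def by force
next
  case (Suc m)
  have e: "expr_val e s \<noteq> NIL" using Suc.prems by blast
  obtain t s' where 1: "exec p s t s'" "t \<le> T" "I (Suc 0) s'"
    using Suc.prems unfolding runs_def by blast
  \<comment> \<open>The remaining \<open>m\<close> rounds start in \<open>s'\<close> and obey the
    invariant with its index shifted by one.\<close>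
  have "runs (While e p) s' ((m + 1) * (1 + expr_time e + T)) (I (Suc m))"
    by (rule Suc.IH[of "\<lambda>i. I (Suc i)" s']) (use 1 Suc.prems(2,3) in auto)
  then obtain t' s'' where 2: "exec (While e p) s' t' s''"
      "t' \<le> (m + 1) * (1 + expr_time e + T)" "I (Suc m) s''"
    unfolding runs_def by blast
  have "exec (While e p) s (1 + expr_time e + t + t') s''"
    using e 1 2 by (blast intro: WhileTrue)
  moreover have "1 + expr_time e + t + t' \<le> (Suc m + 1) * (1 + expr_time e + T)"
    using 1 2 by simp
  ultimately show ?case using 2 unfolding runs_def by blast
qed

section \<open>Subroutines and their closure properties\<close>

lemma tree_size_pos [simp]: "0 < tree_size x" "Suc 0 \<le> tree_size x"
  by (cases x; simp)+

text \<open>A subroutine is started in an arbitrary store, so it can be called repeatedly;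
  all variables from \<open>N\<close> on are left to its callers. A bound on the size of the output
  is needed in addition to the time bound, because repeated execution of
  \<open>X := cons X X\<close> produces a tree of exponential size.\<close>

definition subroutine ::
  "com \<Rightarrow> nat \<Rightarrow> tree set \<Rightarrow> (tree \<Rightarrow> tree) \<Rightarrow> (nat \<Rightarrow> nat) \<Rightarrow> bool" where
  "subroutine p N A f B \<longleftrightarrow> 0 < N \<and>
     (\<forall>s. s 0 \<in> A \<longrightarrow> runs p s (B (tree_size (s 0))) (\<lambda>s'. s' 0 = f (s 0) \<and> (\<forall>i\<ge>N. s' i = s i))) \<and>
     (\<forall>x\<in>A. tree_size (f x) \<le> B (tree_size x))"

text \<open>The domain \<open>A\<close> is kept because the decider for \<open>\<F>\<close> is
  specified only on encodings of graphs. Functions whose programs do not call it are total and fall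
  under \<open>polyf\<close>.\<close>

definition polyf_on :: "tree set \<Rightarrow> (tree \<Rightarrow> tree) \<Rightarrow> bool" where
  "polyf_on A f \<longleftrightarrow> (\<exists>p N B. poly_bounded B \<and> subroutine p N A f B)"

abbreviation polyf :: "(tree \<Rightarrow> tree) \<Rightarrow> bool" where
  "polyf \<equiv> polyf_on UNIV"

lemma polyf_onE:
  assumes "polyf_on A f"
  obtains p N B where "poly_bounded B" "subroutine p N A f B"
  using assms unfolding polyf_on_def by blast

lemma polyf_onI: "poly_bounded B \<Longrightarrow> subroutine p N A f B \<Longrightarrow> polyf_on A f"
  unfolding polyf_on_def by blast

lemma polyf_on_subset: "polyf_on A f \<Longrightarrow> A' \<subseteq> A \<Longrightarrow> polyf_on A' f"
  unfolding polyf_on_def subroutine_def by blast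

lemma subroutine_weaken: "subroutine p N A f B \<Longrightarrow> N \<le> N' \<Longrightarrow> subroutine p N' A f B"
  unfolding subroutine_def
  by (intro conjI allI impI; (elim conjE)?) (auto intro: runs_mono[OF _ order_refl])

lemma subroutine_size: "subroutine p N A f B \<Longrightarrow> x \<in> A \<Longrightarrow> tree_size (f x) \<le> B (tree_size x)"
  by (auto simp: subroutine_def)

lemma subroutine_runs:
  assumes "subroutine p N A f B" "s 0 = x" "x \<in> A"
    and "\<And>s'. s' 0 = f x \<Longrightarrow> (\<And>i. N \<le> i \<Longrightarrow> s' i = s i) \<Longrightarrow> Q s'"
  shows "runs p s (B (tree_size x)) Q"
proof (rule runs_mono[OF _ order_refl])
  show "runs p s (B (tree_size x)) (\<lambda>s'. s' 0 = f x \<and> (\<forall>i\<ge>N. s' i = s i))"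
    using assms(1-3) by (auto simp: subroutine_def)
qed (use assms(4) in auto)

lemma polyf_on_expr:
  assumes "\<And>s. expr_val e s = f (s 0)"
    and "\<And>x. tree_size (f x) \<le> a + tree_size x"
  shows "polyf_on A f"
proof (rule polyf_onI)
  show "poly_bounded (\<lambda>m. (1 + expr_time e + a) + m)" by (intro poly_bounded_intros)
  show "subroutine (Assign 0 e) 1 A f (\<lambda>m. (1 + expr_time e + a) + m)"
    unfolding subroutine_def
  proof (intro conjI allI impI ballI)
    show "runs (Assign 0 e) s (1 + expr_time e + a + tree_size (s 0))
        (\<lambda>s'. s' 0 = f (s 0) \<and> (\<forall>i\<ge>1. s' i = s i))" for s
      by (rule runs_mono[OF runs_Assign order_refl[THEN trans_le_add1, THEN trans_le_add1]])
        (auto simp: assms)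
    show "tree_size (f x) \<le> 1 + expr_time e + a + tree_size x" for x
      using assms(2)[of x] by simp
  qed simp
qed

lemma polyf_on_id: "polyf_on A (\<lambda>x. x)"
  by (rule polyf_on_expr[of "Var 0" _ 0]) auto

fun const_expr :: "tree \<Rightarrow> expr" where
  "const_expr NIL = Nil_e"
| "const_expr (CONS a b) = Cons_e (const_expr a) (const_expr b)"

lemma expr_val_const_expr [simp]: "expr_val (const_expr a) s = a"
  by (induction a) auto

lemma polyf_on_const: "polyf_on A (\<lambda>x. a)"
  by (rule polyf_on_expr[of "const_expr a" _ "tree_size a"]) auto

text \<open>The size bound \<open>F\<close> on the output of the first program turns the running
  time of the second one into \<open>G (F m)\<close>.\<close>

lemma polyf_on_comp:
  assumes "polyf_on A f" "polyf_on B g" "\<And>x. x \<in> A \<Longrightarrow> f x \<in> B"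
  shows "polyf_on A (\<lambda>x. g (f x))"
proof -
  obtain p N F where f: "poly_bounded F" "subroutine p N A f F" using assms polyf_onE by blast
  obtain q M G where g: "poly_bounded G" "subroutine q M B g G" using assms polyf_onE by blast
  define K where "K = max N M"
  have f': "subroutine p K A f F" and g': "subroutine q K B g G"
    by (rule subroutine_weaken, rule f g, simp add: K_def)+
  have le: "G (tree_size (f x)) \<le> G (F (tree_size x))" if "x \<in> A" for x
    using that subroutine_size[OF f'] poly_bounded_monoD[OF g(1)] by blast
  show ?thesis
  proof (rule polyf_onI)
    show "poly_bounded (\<lambda>m. F m + G (F m))" by (intro poly_bounded_add poly_bounded_comp[OF g(1)] f)
    show "subroutine (Seq p q) K A (\<lambda>x. g (f x)) (\<lambda>m. F m + G (F m))"
      unfolding subroutine_def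
    proof (intro conjI allI impI ballI)
      show "0 < K" using f' by (simp add: subroutine_def)
      fix s :: store assume s: "s 0 \<in> A"
      show "runs (Seq p q) s (F (tree_size (s 0)) + G (F (tree_size (s 0))))
          (\<lambda>s'. s' 0 = g (f (s 0)) \<and> (\<forall>i\<ge>K. s' i = s i))"
        apply (rule runs_Seq)
        apply (rule subroutine_runs[OF f', of _ "s 0"])
          apply (use s in auto)[2]
        apply (rule runs_le[OF _ le[OF s]])
        apply (rule subroutine_runs[OF g', of _ "f (s 0)"])
          apply (use s assms(3) in auto)
        done
    next
      fix x assume x: "x \<in> A"
      show "tree_size (g (f x)) \<le> F (tree_size x) + G (F (tree_size x))"
        using subroutine_size[OF g' assms(3)[OF x]] le[OF x] by simp
    qed
  qed
qed

lemma polyf_comp: "polyf g \<Longrightarrow> polyf_on A f \<Longrightarrow> polyf_on A (\<lambda>x. g (f x))"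
  by (rule polyf_on_comp) auto

lemma tree_size_head_le: "tree_size (head x) \<le> tree_size x"
  and tree_size_tail_le: "tree_size (tail x) \<le> tree_size x"
  by (cases x; simp)+

lemma polyf_head: "polyf_on A f \<Longrightarrow> polyf_on A (\<lambda>x. head (f x))"
  by (rule polyf_comp[OF polyf_on_expr[of "Hd_e (Var 0)" _ 0]]) (auto simp: tree_size_head_le)

lemma polyf_tail: "polyf_on A f \<Longrightarrow> polyf_on A (\<lambda>x. tail (f x))"
  by (rule polyf_comp[OF polyf_on_expr[of "Tl_e (Var 0)" _ 0]]) (auto simp: tree_size_tail_le)

lemma polyf_CONS:
  assumes "polyf_on A f" "polyf_on A g"
  shows "polyf_on A (\<lambda>x. CONS (f x) (g x))"
proof -
  obtain p N F where f: "poly_bounded F" "subroutine p N A f F" using assms polyf_onE by blast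
  obtain q M G where g: "poly_bounded G" "subroutine q M A g G" using assms polyf_onE by blast
  define K where "K = max N M"
  have f': "subroutine p K A f F" and g': "subroutine q K A g G"
    by (rule subroutine_weaken, rule f g, simp add: K_def)+
  have K: "0 < K" using f' by (simp add: subroutine_def)
  \<comment> \<open>Neither program touches variables from \<open>K\<close> on: \<open>K\<close>
    preserves the input while \<open>p\<close> runs, and \<open>K + 1\<close> preserves the value of
    \<open>f\<close> while \<open>q\<close> runs.\<close>
  let ?r = "Seq (Assign K (Var 0)) (Seq p (Seq (Assign (K + 1) (Var 0)) (Seq (Assign 0 (Var K))
     (Seq q (Assign 0 (Cons_e (Var (K + 1)) (Var 0)))))))"
  show ?thesis
  proof (rule polyf_onI)
    show "poly_bounded (\<lambda>m. F m + G m + 10)" by (intro poly_bounded_intros f g)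
    show "subroutine ?r (K + 2) A (\<lambda>x. CONS (f x) (g x)) (\<lambda>m. F m + G m + 10)"
      unfolding subroutine_def
    proof (intro conjI allI impI ballI)
      fix s :: store assume s: "s 0 \<in> A"
      show "runs ?r s (F (tree_size (s 0)) + G (tree_size (s 0)) + 10)
          (\<lambda>s'. s' 0 = CONS (f (s 0)) (g (s 0)) \<and> (\<forall>i\<ge>K + 2. s' i = s i))"
        apply (rule runs_le)
          apply (rule runs_Seq runs_Assign)+
          apply (rule subroutine_runs[OF f', of _ "s 0"])
        using K s apply (auto)[2]
          apply (rule runs_Seq runs_Assign)+
          apply (rule subroutine_runs[OF g', of _ "s 0"])
        using K s apply (auto)[2]
          apply (rule runs_Assign)
        using K apply auto
        done
    next
      fix x assume x: "x \<in> A"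
      show "tree_size (CONS (f x) (g x)) \<le> F (tree_size x) + G (tree_size x) + 10"
        using subroutine_size[OF f' x] subroutine_size[OF g' x] by simp
    qed simp
  qed
qed

definition bool_tree :: "bool \<Rightarrow> tree" where
  "bool_tree b = (if b then CONS NIL NIL else NIL)"

lemma bool_tree_eq_NIL [simp]: "bool_tree b = NIL \<longleftrightarrow> \<not> b"
  and tree_size_bool_tree: "tree_size (bool_tree b) \<le> 3"
  by (auto simp: bool_tree_def)

definition polyp :: "(tree \<Rightarrow> bool) \<Rightarrow> bool" where
  "polyp P \<longleftrightarrow> polyf (\<lambda>x. bool_tree (P x))"

text \<open>The test overwrites variable 0, so the input is saved in \<open>K\<close> and restored
  at the start of either branch. Adding the two bounds covers whichever branch is taken.\<close>

lemma polyf_if: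
  assumes "polyp P" "polyf f" "polyf g"
  shows "polyf (\<lambda>x. if P x then f x else g x)"
proof -
  obtain r L H where h: "poly_bounded H" "subroutine r L UNIV (\<lambda>x. bool_tree (P x)) H"
    using assms polyf_onE unfolding polyp_def by blast
  obtain p N F where f: "poly_bounded F" "subroutine p N UNIV f F" using assms polyf_onE by blast
  obtain q M G where g: "poly_bounded G" "subroutine q M UNIV g G" using assms polyf_onE by blast
  define K where "K = max L (max N M)"
  have h': "subroutine r K UNIV (\<lambda>x. bool_tree (P x)) H" and f': "subroutine p K UNIV f F"
    and g': "subroutine q K UNIV g G"
    by (rule subroutine_weaken, rule h f g, simp add: K_def)+
  have K: "0 < K" using f' by (simp add: subroutine_def)
  let ?r = "Seq (Assign K (Var 0)) (Seq r (If (Var 0) (Seq (Assign 0 (Var K)) p)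
     (Seq (Assign 0 (Var K)) q)))"
  show ?thesis
  proof (rule polyf_onI)
    show "poly_bounded (\<lambda>m. 6 + (H m + (F m + G m)))" by (intro poly_bounded_intros f g h)
    show "subroutine ?r (K + 1) UNIV (\<lambda>x. if P x then f x else g x) (\<lambda>m. 6 + (H m + (F m + G m)))"
      unfolding subroutine_def
    proof (intro conjI allI impI ballI)
      fix s :: store
      let ?T = "F (tree_size (s 0)) + G (tree_size (s 0))"
      let ?Q = "\<lambda>s'. s' 0 = (if P (s 0) then f (s 0) else g (s 0)) \<and> (\<forall>i\<ge>K + 1. s' i = s i)"
      have branch: "runs (If (Var 0) (Seq (Assign 0 (Var K)) p) (Seq (Assign 0 (Var K)) q)) s'
          (1 + expr_time (Var 0) + (2 + ?T)) ?Q"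
        if s': "s' 0 = bool_tree (P (s 0))" "\<And>i. K \<le> i \<Longrightarrow> s' i = (s(K := s 0)) i" for s'
      proof (rule runs_If)
        assume "expr_val (Var 0) s' \<noteq> NIL"
        then have P: "P (s 0)" using s' by simp
        show "runs (Seq (Assign 0 (Var K)) p) s' (2 + ?T) ?Q"
          by (rule runs_le[of _ _ "(1 + expr_time (Var K)) + F (tree_size (s 0))"],
              intro runs_Seq runs_Assign, rule subroutine_runs[OF f'])
            (use K P s' in auto)
      next
        assume "expr_val (Var 0) s' = NIL"
        then have P: "\<not> P (s 0)" using s' by simp
        show "runs (Seq (Assign 0 (Var K)) q) s' (2 + ?T) ?Q"
          by (rule runs_le[of _ _ "(1 + expr_time (Var K)) + G (tree_size (s 0))"],
              intro runs_Seq runs_Assign, rule subroutine_runs[OF g'])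
            (use K P s' in auto)
      qed
      show "runs ?r s (6 + (H (tree_size (s 0)) + ?T)) ?Q"
        apply (rule runs_le)
          apply (rule runs_Seq runs_Assign)+
          apply (rule subroutine_runs[OF h', of _ "s 0"])
        using K apply (auto)[2]
          apply (rule branch)
        using K apply auto
        done
    next
      fix x :: tree
      show "tree_size (if P x then f x else g x) \<le> 6 + (H (tree_size x) + (F (tree_size x) + G (tree_size x)))"
        using subroutine_size[OF f', of x] subroutine_size[OF g', of x] by simp
    qed simp
  qed
qed

section \<open>List processing in polynomial time\<close>

text \<open>Every tree is a list along its right spine, so list operations are total on trees and
  \<open>lst\<close> is a two-sided inverse of \<open>enc_list\<close>.\<close>

fun lst :: "tree \<Rightarrow> tree list" where
  "lst NIL = []"
| "lst (CONS a b) = a # lst b"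

lemma lst_enc_list [simp]: "lst (enc_list xs) = xs"
  by (induction xs) auto

lemma enc_list_lst [simp]: "enc_list (lst x) = x"
  by (induction x) auto

lemma tree_size_enc_list: "tree_size (enc_list xs) = 1 + (\<Sum>x\<leftarrow>xs. tree_size x + 1)"
  by (induction xs) auto

lemma length_lst_le: "length (lst x) \<le> tree_size x"
  by (induction x) auto

lemma tree_size_lst: "tree_size x = 1 + (\<Sum>y\<leftarrow>lst x. tree_size y + 1)"
  using tree_size_enc_list[of "lst x"] by simp

lemma tree_size_elem: "y \<in> set (lst x) \<Longrightarrow> tree_size y \<le> tree_size x"
  by (induction x) auto

text \<open>A polynomial step function alone could make the accumulator grow exponentially, hence
  the assumption \<open>size\<close>, which bounds it after every prefix of the list. The step
  function sees the element, the accumulator and the whole input; several arguments are passed as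
  nested pairs, here and in the rules below.\<close>

lemma polyf_foldl:
  assumes h: "polyf (\<lambda>y. h (head y) (head (tail y)) (tail (tail y)))"
    and i: "polyf i" and g: "polyf g" and b: "poly_bounded B"
    and size: "\<And>x ys zs. lst (g x) = ys @ zs \<Longrightarrow>
      tree_size (foldl (\<lambda>acc a. h a acc x) (i x) ys) \<le> B (tree_size x)"
  shows "polyf (\<lambda>x. foldl (\<lambda>acc a. h a acc x) (i x) (lst (g x)))"
proof -
  let ?h = "\<lambda>y. h (head y) (head (tail y)) (tail (tail y))"
  obtain r L H where h: "poly_bounded H" "subroutine r L UNIV ?h H" using h polyf_onE by blast
  obtain p N F where f: "poly_bounded F" "subroutine p N UNIV i F" using i polyf_onE by blast
  obtain q M G where g: "poly_bounded G" "subroutine q M UNIV g G" using g polyf_onE by blast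
  define K where "K = max L (max N M)"
  have h': "subroutine r K UNIV ?h H" and f': "subroutine p K UNIV i F"
    and g': "subroutine q K UNIV g G"
    by (rule subroutine_weaken, rule h f g, simp add: K_def)+
  have K: "0 < K" using f' by (simp add: subroutine_def)
  \<comment> \<open>Variable \<open>K\<close> holds the input, \<open>K + 1\<close> the part of the
    list still to be processed, \<open>K + 2\<close> the accumulator.\<close>
  let ?body = "Seq (Assign 0 (Cons_e (Hd_e (Var (K + 1))) (Cons_e (Var (K + 2)) (Var K))))
    (Seq r (Seq (Assign (K + 2) (Var 0)) (Assign (K + 1) (Tl_e (Var (K + 1))))))"
  let ?r = "Seq (Assign K (Var 0)) (Seq q (Seq (Assign (K + 1) (Var 0)) (Seq (Assign 0 (Var K))
    (Seq p (Seq (Assign (K + 2) (Var 0)) (Seq (While (Var (K + 1)) ?body) (Assign 0 (Var (K + 2)))))))))"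
  \<comment> \<open>The argument of the step program consists of an element of size at most
    \<open>G m\<close>, an accumulator of size at most \<open>B m\<close>, the input and two pairing
    cells; 13 covers the assignments around the call.\<close>
  define T where "T m = 13 + H (G m + (B m + (m + 2)))" for m
  show ?thesis
  proof (rule polyf_onI)
    show "poly_bounded (\<lambda>m. 10 + (G m + (F m + ((G m + 1) * (2 + T m) + B m))))"
      unfolding T_def
      by (intro poly_bounded_intros f g b poly_bounded_comp[OF h(1)])
    show "subroutine ?r (K + 3) UNIV (\<lambda>x. foldl (\<lambda>acc a. h a acc x) (i x) (lst (g x)))
        (\<lambda>m. 10 + (G m + (F m + ((G m + 1) * (2 + T m) + B m))))"
      unfolding subroutine_def
    proof (intro conjI allI impI ballI)
      fix s :: store
      define x where "x = s 0"
      let ?xs = "lst (g x)"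
      define fo where "fo k = foldl (\<lambda>acc a. h a acc x) (i x) (take k ?xs)" for k
      define I where "I k s' \<longleftrightarrow> s' K = x \<and> s' (K + 1) = enc_list (drop k ?xs) \<and>
        s' (K + 2) = fo k \<and> (\<forall>j\<ge>K + 3. s' j = s j)" for k and s' :: store
      have fo_size: "tree_size (fo k) \<le> B (tree_size x)" for k
        unfolding fo_def by (rule size[of x _ "drop k ?xs"]) simp
      have g_size: "tree_size (g x) \<le> G (tree_size x)"
        using subroutine_size[OF g'] by simp
      have body: "expr_val (Var (K + 1)) s' \<noteq> NIL \<and> runs ?body s' (T (tree_size x)) (I (Suc k))"
        if k: "k < length ?xs" and I: "I k s'" for k s'
      proof
        have d: "drop k ?xs = ?xs ! k # drop (Suc k) ?xs" using k by (rule Cons_nth_drop_Suc[symmetric])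
        have e: "s' (K + 1) = CONS (?xs ! k) (enc_list (drop (Suc k) ?xs))"
          using I d by (simp add: I_def)
        then show "expr_val (Var (K + 1)) s' \<noteq> NIL" by simp
        have fS: "fo (Suc k) = h (?xs ! k) (fo k) x"
          using k by (simp add: fo_def take_Suc_conv_app_nth)
        let ?y = "CONS (?xs ! k) (CONS (fo k) x)"
        have "tree_size (?xs ! k) \<le> tree_size (g x)"
          using k by (intro tree_size_elem) simp
        then have "tree_size ?y \<le> G (tree_size x) + (B (tree_size x) + (tree_size x + 2))"
          using fo_size[of k] g_size by simp
        then have Hle: "H (tree_size ?y) \<le> H (G (tree_size x) + (B (tree_size x) + (tree_size x + 2)))"
          by (rule poly_bounded_monoD[OF h(1)])
        show "runs ?body s' (T (tree_size x)) (I (Suc k))"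
          apply (rule runs_le)
            apply (rule runs_Seq runs_Assign)+
            apply (rule subroutine_runs[OF h', of _ ?y])
          using K e I apply (simp add: I_def d, simp)
            apply (rule runs_Seq runs_Assign)+
          using K I fS Hle apply (auto simp: I_def T_def d)
          done
      qed
      have loop: "runs (While (Var (K + 1)) ?body) s'
          ((G (tree_size x) + 1) * (2 + T (tree_size x))) (I (length ?xs))" if "I 0 s'" for s'
      proof (rule runs_mono[OF runs_While[of I, OF that body]])
        show "expr_val (Var (K + 1)) s'' = NIL" if "I (length ?xs) s''" for s''
          using that by (simp add: I_def)
        have "length ?xs \<le> G (tree_size x)" using g_size length_lst_le[of "g x"] by simp
        then show "(length ?xs + 1) * (1 + expr_time (Var (K + 1)) + T (tree_size x))
            \<le> (G (tree_size x) + 1) * (2 + T (tree_size x))"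
          by (intro mult_mono) auto
      qed auto
      show "runs ?r s (10 + (G (tree_size (s 0)) + (F (tree_size (s 0)) +
            ((G (tree_size (s 0)) + 1) * (2 + T (tree_size (s 0))) + B (tree_size (s 0))))))
          (\<lambda>s'. s' 0 = foldl (\<lambda>acc a. h a acc (s 0)) (i (s 0)) (lst (g (s 0))) \<and> (\<forall>i\<ge>K + 3. s' i = s i))"
        unfolding x_def[symmetric]
        apply (rule runs_le)
          apply (rule runs_Seq runs_Assign)+
          apply (rule subroutine_runs[OF g', of _ x])
        using K apply (auto simp: x_def)[2]
          apply (rule runs_Seq runs_Assign)+
          apply (rule subroutine_runs[OF f', of _ x])
        using K apply (auto simp: x_def)[2]
          apply (rule runs_Seq runs_Assign)+
          apply (rule runs_mono[OF loop order_refl])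
        using K apply (auto simp: I_def fo_def x_def)[1]
          apply (rule runs_Assign)
        using K apply (auto simp: I_def fo_def)
        done
    next
      fix x :: tree
      show "tree_size (foldl (\<lambda>acc a. h a acc x) (i x) (lst (g x))) \<le> 10 + (G (tree_size x) +
         (F (tree_size x) + ((G (tree_size x) + 1) * (2 + T (tree_size x)) + B (tree_size x))))"
        using size[of x "lst (g x)" "[]"] by simp
    qed simp
  qed
qed

lemma polyf_neNIL: "polyf (\<lambda>x. bool_tree (x \<noteq> NIL))"
proof (rule polyf_onI)
  let ?p = "If (Var 0) (Assign 0 (Cons_e Nil_e Nil_e)) (Assign 0 Nil_e)"
  show "poly_bounded (\<lambda>m. 6)" by (rule poly_bounded_const)
  have "runs ?p s 6 (\<lambda>s'. s' 0 = bool_tree (s 0 \<noteq> NIL) \<and> (\<forall>i\<ge>1. s' i = s i))" for s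
    by (rule runs_le, rule runs_If[where T = 4])
      (auto intro!: runs_le[OF runs_Assign] simp: bool_tree_def)
  then show "subroutine ?p 1 UNIV (\<lambda>x. bool_tree (x \<noteq> NIL)) (\<lambda>m. 6)"
    using tree_size_bool_tree by (auto simp: subroutine_def bool_tree_def)
qed

lemma polyp_neNIL: "polyf f \<Longrightarrow> polyp (\<lambda>x. f x \<noteq> NIL)"
  unfolding polyp_def by (rule polyf_comp[OF polyf_neNIL])

lemma polyp_comp: "polyp P \<Longrightarrow> polyf f \<Longrightarrow> polyp (\<lambda>x. P (f x))"
  unfolding polyp_def by (rule polyf_comp)

lemma polyp_not:
  assumes "polyp P"
  shows "polyp (\<lambda>x. \<not> P x)"
proof -
  have "polyf (\<lambda>x. if P x then bool_tree False else bool_tree True)"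
    by (intro polyf_if assms polyf_on_const)
  moreover have "(\<lambda>x. if P x then bool_tree False else bool_tree True) = (\<lambda>x. bool_tree (\<not> P x))"
    by auto
  ultimately show ?thesis by (simp add: polyp_def)
qed

lemma polyp_conj: 
  assumes "polyp P" "polyp Q" 
  shows "polyp (\<lambda>x. P x \<and> Q x)"
proof -
  have "polyf (\<lambda>x. if P x then bool_tree (Q x) else NIL)"
    using assms by (intro polyf_if polyf_on_const) (auto simp: polyp_def)
  moreover have "(\<lambda>x. if P x then bool_tree (Q x) else NIL) = (\<lambda>x. bool_tree (P x \<and> Q x))"
    by (auto simp: bool_tree_def)
  ultimately show ?thesis by (simp add: polyp_def)
qed

lemma polyp_eqNIL: "polyf f \<Longrightarrow> polyp (\<lambda>x. f x = NIL)"
  by (drule polyp_neNIL, drule polyp_not) simp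

lemma polyp_disj:
  assumes "polyp P" "polyp Q"
  shows "polyp (\<lambda>x. P x \<or> Q x)"
  using polyp_not[OF polyp_conj[OF polyp_not[OF assms(1)] polyp_not[OF assms(2)]]] by simp

lemma polyp_iff:
  assumes "polyp P" "polyp Q"
  shows "polyp (\<lambda>x. P x = Q x)"
proof -
  have "polyp (\<lambda>x. (P x \<and> Q x) \<or> (\<not> P x \<and> \<not> Q x))"
    by (intro polyp_disj polyp_conj polyp_not assms)
  moreover have "(\<lambda>x. (P x \<and> Q x) \<or> (\<not> P x \<and> \<not> Q x)) = (\<lambda>x. P x = Q x)"
    by auto
  ultimately show ?thesis by simp
qed

lemma polyf_bool_tree: "polyp P \<Longrightarrow> polyf (\<lambda>x. bool_tree (P x))"
  by (simp add: polyp_def)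

lemmas polyf_intros = polyf_on_const polyf_on_id polyf_head polyf_tail polyf_CONS polyf_if polyf_bool_tree
  polyp_neNIL polyp_not polyp_conj polyp_eqNIL polyp_disj polyp_iff

text \<open>A fold whose accumulator is always a truth value, so 3 bounds its size.\<close>

lemma polyp_bex:
  assumes P: "polyp (\<lambda>y. P (head y) (tail y))" and g: "polyf g"
  shows "polyp (\<lambda>x. \<exists>a\<in>set (lst (g x)). P a x)"
proof -
  let ?h = "\<lambda>a acc x. if P a x then bool_tree True else acc"
  have eq: "foldl (\<lambda>acc a. ?h a acc x) (bool_tree b) ys = bool_tree (b \<or> (\<exists>a\<in>set ys. P a x))" for x b ys
  proof (induction ys arbitrary: b)
    case (Cons a ys)
    then show ?case by (cases "P a x") auto
  qed simp
  have "polyf (\<lambda>x. foldl (\<lambda>acc a. ?h a acc x) (bool_tree False) (lst (g x)))"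
  proof (rule polyf_foldl[OF _ polyf_on_const g poly_bounded_const[of 3]])
    have "polyp (\<lambda>y. (\<lambda>y. P (head y) (tail y)) (CONS (head y) (tail (tail y))))"
      by (rule polyp_comp[OF P]) (intro polyf_intros)
    then show "polyf (\<lambda>y. if P (head y) (tail (tail y)) then bool_tree True else head (tail y))"
      by (intro polyf_intros) simp
  qed (simp add: eq tree_size_bool_tree)
  then show ?thesis by (simp add: polyp_def eq)
qed

lemma polyp_ball:
  assumes "polyp (\<lambda>y. P (head y) (tail y))" "polyf g"
  shows "polyp (\<lambda>x. \<forall>a\<in>set (lst (g x)). P a x)"
  using polyp_not[OF polyp_bex[of "\<lambda>a x. \<not> P a x" g, OF polyp_not[OF assms(1)] assms(2)]] by simp

lemma polyf_rev:
  assumes "polyf g"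
  shows "polyf (\<lambda>x. enc_list (rev (lst (g x))))"
proof -
  have eq: "foldl (\<lambda>acc a. CONS a acc) (enc_list zs) ys = enc_list (rev ys @ zs)" for ys zs
    by (induction ys arbitrary: zs) (auto simp flip: enc_list.simps)
  have eq0: "foldl (\<lambda>acc a. CONS a acc) NIL ys = enc_list (rev ys)" for ys
    using eq[of "[]" ys] by simp
  obtain p N G where G: "poly_bounded G" "subroutine p N UNIV g G"
    using polyf_onE[OF assms] by blast
  have "polyf (\<lambda>x. foldl (\<lambda>acc a. CONS a acc) NIL (lst (g x)))"
  proof (rule polyf_foldl[OF _ polyf_on_const assms G(1)])
    show "polyf (\<lambda>y. CONS (head y) (head (tail y)))" by (intro polyf_intros)
    fix x ys zs assume *: "lst (g x) = ys @ zs"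
    have "tree_size (enc_list (rev ys)) \<le> tree_size (g x)"
      unfolding tree_size_lst[of "g x"] * tree_size_enc_list by (simp flip: rev_map)
    then show "tree_size (foldl (\<lambda>acc a. CONS a acc) NIL ys) \<le> G (tree_size x)"
      using subroutine_size[OF G(2), of x] by (simp add: eq0)
  qed
  then show ?thesis by (simp add: eq0)
qed

text \<open>A right fold is a left fold over the reversed list. The size condition accordingly
  concerns suffixes.\<close>

lemma polyf_foldr:
  assumes "polyf (\<lambda>y. h (head y) (head (tail y)) (tail (tail y)))"
    and "polyf i" and "polyf g" and "poly_bounded B"
    and "\<And>x ys zs. lst (g x) = zs @ ys \<Longrightarrow>
      tree_size (foldr (\<lambda>a acc. h a acc x) ys (i x)) \<le> B (tree_size x)"
  shows "polyf (\<lambda>x. foldr (\<lambda>a acc. h a acc x) (lst (g x)) (i x))"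
proof -
  have "polyf (\<lambda>x. foldl (\<lambda>acc a. h a acc x) (i x) (lst (enc_list (rev (lst (g x))))))"
  proof (rule polyf_foldl[OF assms(1,2) polyf_rev[OF assms(3)] assms(4)])
    fix x ys zs assume "lst (enc_list (rev (lst (g x)))) = ys @ zs"
    then have "lst (g x) = rev zs @ rev ys" by (simp add: rev_swap)
    from assms(5)[OF this]
    show "tree_size (foldl (\<lambda>acc a. h a acc x) (i x) ys) \<le> B (tree_size x)"
      by (simp add: foldr_conv_foldl)
  qed
  then show ?thesis by (simp add: foldr_conv_foldl)
qed

lemma polyf_map:
  assumes f: "polyf (\<lambda>y. f (head y) (tail y))" and g: "polyf g"
  shows "polyf (\<lambda>x. enc_list (map (\<lambda>a. f a x) (lst (g x))))"
proof -
  have eq: "foldr (\<lambda>a acc. CONS (f a x) acc) ys NIL = enc_list (map (\<lambda>a. f a x) ys)" for ys x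
    by (induction ys) auto
  obtain p N G where G: "poly_bounded G" "subroutine p N UNIV g G"
    using polyf_onE[OF g] by blast
  obtain q M F where F: "poly_bounded F" "subroutine q M UNIV (\<lambda>y. f (head y) (tail y)) F"
    using polyf_onE[OF f] by blast
  \<comment> \<open>There are at most \<open>G m\<close> results, and each comes from a pair of an
    element of size at most \<open>G m\<close> and the input.\<close>
  let ?B = "\<lambda>m. 1 + G m * (F (G m + (m + 1)) + 1)"
  have "polyf (\<lambda>x. foldr (\<lambda>a acc. CONS (f a x) acc) (lst (g x)) NIL)"
  proof (rule polyf_foldr[OF _ polyf_on_const g])
    have "polyf (\<lambda>y. (\<lambda>y. f (head y) (tail y)) (CONS (head y) (tail (tail y))))"
      by (rule polyf_comp[OF f]) (intro polyf_intros)
    then show "polyf (\<lambda>y. CONS (f (head y) (tail (tail y))) (head (tail y)))"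
      by (intro polyf_intros) simp
    show "poly_bounded ?B"
      by (intro poly_bounded_intros G(1) poly_bounded_comp[OF F(1)])
    fix x ys zs assume *: "lst (g x) = zs @ ys"
    let ?m = "tree_size x"
    have gs: "tree_size (g x) \<le> G ?m" using subroutine_size[OF G(2), of x] by simp
    have "tree_size (f a x) \<le> F (G ?m + (?m + 1))" if "a \<in> set ys" for a
    proof -
      have "tree_size a \<le> tree_size (g x)" using that * by (intro tree_size_elem) simp
      then have "tree_size (CONS a x) \<le> G ?m + (?m + 1)" using gs by simp
      then have "F (tree_size (CONS a x)) \<le> F (G ?m + (?m + 1))" by (rule poly_bounded_monoD[OF F(1)])
      then show ?thesis using subroutine_size[OF F(2), of "CONS a x"] by simp
    qed
    then have "(\<Sum>a\<leftarrow>ys. tree_size (f a x) + 1) \<le> (\<Sum>a\<leftarrow>ys. F (G ?m + (?m + 1)) + 1)"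
      by (intro sum_list_mono) auto
    also have "\<dots> = length ys * (F (G ?m + (?m + 1)) + 1)" by (simp add: sum_list_triv)
    also have "\<dots> \<le> G ?m * (F (G ?m + (?m + 1)) + 1)"
      using length_lst_le[of "g x"] gs * by (intro mult_le_mono1) simp
    finally show "tree_size (foldr (\<lambda>a acc. CONS (f a x) acc) ys NIL) \<le> ?B ?m"
      by (simp add: eq tree_size_enc_list o_def)
  qed
  then show ?thesis by (simp add: eq)
qed

lemma polyf_filter:
  assumes P: "polyp (\<lambda>y. P (head y) (tail y))" and g: "polyf g"
  shows "polyf (\<lambda>x. enc_list (filter (\<lambda>a. P a x) (lst (g x))))"
proof -
  let ?h = "\<lambda>a acc x. if P a x then CONS a acc else acc"
  have eq: "foldr (\<lambda>a acc. ?h a acc x) ys NIL = enc_list (filter (\<lambda>a. P a x) ys)" for ys x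
    by (induction ys) auto
  obtain p N G where G: "poly_bounded G" "subroutine p N UNIV g G"
    using polyf_onE[OF g] by blast
  have "polyf (\<lambda>x. foldr (\<lambda>a acc. ?h a acc x) (lst (g x)) NIL)"
  proof (rule polyf_foldr[OF _ polyf_on_const g G(1)])
    have "polyp (\<lambda>y. (\<lambda>y. P (head y) (tail y)) (CONS (head y) (tail (tail y))))"
      by (rule polyp_comp[OF P]) (intro polyf_intros)
    then show "polyf (\<lambda>y. if P (head y) (tail (tail y)) then CONS (head y) (head (tail y))
        else head (tail y))"
      by (intro polyf_intros) simp
    fix x ys zs assume *: "lst (g x) = zs @ ys"
    have "(\<Sum>a\<leftarrow>filter (\<lambda>a. P a x) ys. tree_size a + 1) \<le> (\<Sum>a\<leftarrow>ys. tree_size a + 1)"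
      by (induction ys) auto
    then have "tree_size (enc_list (filter (\<lambda>a. P a x) ys)) \<le> tree_size (g x)"
      unfolding tree_size_lst[of "g x"] * tree_size_enc_list by simp
    then show "tree_size (foldr (\<lambda>a acc. ?h a acc x) ys NIL) \<le> G (tree_size x)"
      using subroutine_size[OF G(2), of x] by (simp add: eq)
  qed
  then show ?thesis by (simp add: eq)
qed

lemma polyf_append:
  assumes f: "polyf f" and g: "polyf g"
  shows "polyf (\<lambda>x. enc_list (lst (f x) @ lst (g x)))"
proof -
  have eq: "foldr (\<lambda>a acc. CONS a acc) ys z = enc_list (ys @ lst z)" for ys z
    by (induction ys) auto
  obtain p N F where F: "poly_bounded F" "subroutine p N UNIV f F"
    using polyf_onE[OF f] by blast
  obtain q M G where G: "poly_bounded G" "subroutine q M UNIV g G"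
    using polyf_onE[OF g] by blast
  have "polyf (\<lambda>x. foldr (\<lambda>a acc. CONS a acc) (lst (f x)) (g x))"
  proof (rule polyf_foldr[OF _ g f poly_bounded_add[OF F(1) G(1)]])
    show "polyf (\<lambda>y. CONS (head y) (head (tail y)))" by (intro polyf_intros)
    fix x ys zs assume *: "lst (f x) = zs @ ys"
    have "tree_size (enc_list (ys @ lst (g x))) \<le> tree_size (f x) + tree_size (g x)"
      unfolding tree_size_lst[of "f x"] tree_size_lst[of "g x"] * tree_size_enc_list by simp
    then show "tree_size (foldr (\<lambda>a acc. CONS a acc) ys (g x)) \<le> F (tree_size x) + G (tree_size x)"
      using subroutine_size[OF F(2), of x] subroutine_size[OF G(2), of x] by (simp add: eq)
  qed
  then show ?thesis by (simp add: eq)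
qed

lemma polyf_concat:
  assumes g: "polyf g"
  shows "polyf (\<lambda>x. enc_list (concat (map lst (lst (g x)))))"
proof -
  have eq: "foldr (\<lambda>a acc. enc_list (lst a @ lst acc)) ys NIL = enc_list (concat (map lst ys))" for ys
    by (induction ys) auto
  obtain p N G where G: "poly_bounded G" "subroutine p N UNIV g G"
    using polyf_onE[OF g] by blast
  have "polyf (\<lambda>x. foldr (\<lambda>a acc. enc_list (lst a @ lst acc)) (lst (g x)) NIL)"
  proof (rule polyf_foldr[OF _ polyf_on_const g G(1)])
    show "polyf (\<lambda>y. enc_list (lst (head y) @ lst (head (tail y))))"
      by (intro polyf_append polyf_intros)
    fix x ys zs assume *: "lst (g x) = zs @ ys"
    have "tree_size (enc_list (concat (map lst ys))) \<le> tree_size (enc_list ys)"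
    proof (induction ys)
      case (Cons a ys)
      then show ?case using tree_size_lst[of a] by (simp add: tree_size_enc_list)
    qed simp
    also have "\<dots> \<le> tree_size (g x)"
      unfolding tree_size_lst[of "g x"] * tree_size_enc_list by simp
    finally show "tree_size (foldr (\<lambda>a acc. enc_list (lst a @ lst acc)) ys NIL) \<le> G (tree_size x)"
      using subroutine_size[OF G(2), of x] by (simp add: eq)
  qed
  then show ?thesis by (simp add: eq)
qed

text \<open>As trees can only be tested for \<open>NIL\<close>, this one operation provides list
  indexing, truncated subtraction of unary numbers and thereby their comparison.\<close>

definition drop_tree :: "tree \<Rightarrow> tree \<Rightarrow> tree" where
  "drop_tree x y = foldl (\<lambda>acc a. tail acc) x (lst y)"

lemma polyf_drop_tree:
  assumes f: "polyf f" and g: "polyf g"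
  shows "polyf (\<lambda>x. drop_tree (f x) (g x))"
proof -
  obtain p N F where F: "poly_bounded F" "subroutine p N UNIV f F"
    using polyf_onE[OF f] by blast
  have "polyf (\<lambda>x. foldl (\<lambda>acc a. tail acc) (f x) (lst (g x)))"
  proof (rule polyf_foldl[OF _ f g F(1)])
    show "polyf (\<lambda>y. tail (head (tail y)))" by (intro polyf_intros)
    fix x ys zs
    have "tree_size (foldl (\<lambda>acc a. tail acc) z ys) \<le> tree_size z" for z
      by (induction ys arbitrary: z) (auto intro: order_trans tree_size_tail_le)
    then show "tree_size (foldl (\<lambda>acc a. tail acc) (f x) ys) \<le> F (tree_size x)"
      using subroutine_size[OF F(2), of x] order_trans by blast
  qed
  then show ?thesis by (simp add: drop_tree_def)
qed

section \<open>Calling a foreign program as a subroutine\<close>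

fun expr_bound :: "expr \<Rightarrow> nat" where
  "expr_bound (Var x) = Suc x"
| "expr_bound Nil_e = 0"
| "expr_bound (Cons_e e f) = max (expr_bound e) (expr_bound f)"
| "expr_bound (Hd_e e) = expr_bound e"
| "expr_bound (Tl_e e) = expr_bound e"

fun com_bound :: "com \<Rightarrow> nat" where
  "com_bound (Assign x e) = max (Suc x) (expr_bound e)"
| "com_bound (Seq p q) = max (com_bound p) (com_bound q)"
| "com_bound (If e p q) = max (expr_bound e) (max (com_bound p) (com_bound q))"
| "com_bound (While e p) = max (expr_bound e) (com_bound p)"

lemma expr_val_agree:
  "expr_bound e \<le> N \<Longrightarrow> \<forall>i<N. s' i = s i \<Longrightarrow> expr_val e s' = expr_val e s"
  by (induction e) auto

text \<open>A program reads and writes only variables below its bound. So a run from the initial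
  store can be repeated in any store that agrees with it there, and the callers' variables
  survive.\<close>

lemma exec_agree:
  assumes "exec p s t s'" "com_bound p \<le> N" "\<forall>i<N. r i = s i"
  shows "\<exists>r'. exec p r t r' \<and> (\<forall>i<N. r' i = s' i) \<and> (\<forall>i\<ge>N. r' i = r i)"
  using assms
proof (induction arbitrary: r rule: exec.induct)
  case (Assign x e s)
  then have "expr_val e r = expr_val e s" by (intro expr_val_agree) auto
  with Assign show ?case
    by (intro exI[of _ "r(x := expr_val e r)"] conjI exec.Assign) auto
next
  case (Seq p s t s' q t' s'')
  obtain r' where 1: "exec p r t r'" "\<forall>i<N. r' i = s' i" "\<forall>i\<ge>N. r' i = r i"
    using Seq.IH(1)[of r] Seq.prems by auto
  obtain r'' where 2: "exec q r' t' r''" "\<forall>i<N. r'' i = s'' i" "\<forall>i\<ge>N. r'' i = r' i"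
    using Seq.IH(2)[of r'] Seq.prems 1 by auto
  show ?case using 1 2 by (intro exI[of _ r'']) (auto intro: exec.Seq)
next
  case (IfTrue e s p t s' q)
  have "expr_val e r = expr_val e s" using IfTrue.prems by (intro expr_val_agree) auto
  moreover obtain r' where "exec p r t r'" "\<forall>i<N. r' i = s' i" "\<forall>i\<ge>N. r' i = r i"
    using IfTrue.IH[of r] IfTrue.prems by auto
  ultimately show ?case using IfTrue.hyps by (metis exec.IfTrue)
next
  case (IfFalse e s q t s' p)
  have "expr_val e r = expr_val e s" using IfFalse.prems by (intro expr_val_agree) auto
  moreover obtain r' where "exec q r t r'" "\<forall>i<N. r' i = s' i" "\<forall>i\<ge>N. r' i = r i"
    using IfFalse.IH[of r] IfFalse.prems by auto
  ultimately show ?case using IfFalse.hyps by (metis exec.IfFalse)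
next
  case (WhileFalse e s p)
  have "expr_val e r = expr_val e s" using WhileFalse.prems by (intro expr_val_agree) auto
  then show ?case using WhileFalse by (metis exec.WhileFalse)
next
  case (WhileTrue e s p t s' t' s'')
  have e: "expr_val e r = expr_val e s" using WhileTrue.prems by (intro expr_val_agree) auto
  obtain r' where 1: "exec p r t r'" "\<forall>i<N. r' i = s' i" "\<forall>i\<ge>N. r' i = r i"
    using WhileTrue.IH(1)[of r] WhileTrue.prems by auto
  obtain r'' where 2: "exec (While e p) r' t' r''" "\<forall>i<N. r'' i = s'' i" "\<forall>i\<ge>N. r'' i = r' i"
    using WhileTrue.IH(2)[of r'] WhileTrue.prems 1 by auto
  show ?case using 1 2 e WhileTrue.hyps
    by (intro exI[of _ r''] conjI exec.WhileTrue[of e r p t r' t' r'']) auto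
qed

inductive_cases exec_AssignE: "exec (Assign x e) s t s'"
inductive_cases exec_SeqE: "exec (Seq p q) s t s'"
inductive_cases exec_IfE: "exec (If e p q) s t s'"
inductive_cases exec_WhileE: "exec (While e p) s t s'"

text \<open>Encodings are not assumed to be injective. Determinism ensures that two instances with
  the same code receive the same answer, so the answer is a function of the code.\<close>

lemma exec_deterministic: "exec p s t s1 \<Longrightarrow> exec p s t' s2 \<Longrightarrow> s1 = s2"
proof (induction arbitrary: t' s2 rule: exec.induct)
  case (Assign x e s)
  then show ?case by (elim exec_AssignE) simp
next
  case (Seq p s t s' q t'' s'')
  from Seq.prems obtain u r u' where 1: "exec p s u r" "exec q r u' s2" by (rule exec_SeqE)
  have r: "s' = r" by (rule Seq.IH(1)[OF 1(1)])
  show ?case by (rule Seq.IH(2)[unfolded r, OF 1(2)])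
next
  case (IfTrue e s p t s' q)
  from IfTrue.prems obtain u where "exec p s u s2" by (rule exec_IfE) (use IfTrue.hyps in simp_all)
  then show ?case by (rule IfTrue.IH)
next
  case (IfFalse e s q t s' p)
  from IfFalse.prems obtain u where "exec q s u s2" by (rule exec_IfE) (use IfFalse.hyps in simp_all)
  then show ?case by (rule IfFalse.IH)
next
  case (WhileFalse e s p)
  from WhileFalse.prems show ?case by (rule exec_WhileE) (use WhileFalse.hyps in simp_all)
next
  case (WhileTrue e s p t s' t'' s'')
  from WhileTrue.prems obtain u r u' where 1: "exec p s u r" "exec (While e p) r u' s2"
    by (rule exec_WhileE) (use WhileTrue.hyps in simp)
  have r: "s' = r" by (rule WhileTrue.IH(1)[OF 1(1)])
  show ?case by (rule WhileTrue.IH(2)[unfolded r, OF 1(2)])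
qed

text \<open>Restores the situation of \<open>init_store\<close>, where all variables but 0 are
  \<open>NIL\<close>. The base case is a dummy assignment, as the language has no empty
  command.\<close>

fun clear :: "nat \<Rightarrow> com" where
  "clear 0 = Assign 0 (Var 0)"
| "clear (Suc n) = Seq (clear n) (Assign (Suc n) Nil_e)"

lemma runs_clear: "runs (clear n) s (2 + 2 * n) (\<lambda>s'. s' = (\<lambda>i. if 0 < i \<and> i \<le> n then NIL else s i))"
proof (induction n)
  case 0
  show ?case by (auto intro!: runs_le[OF runs_Assign])
next
  case (Suc n)
  have "runs (clear (Suc n)) s ((2 + 2 * n) + (1 + expr_time Nil_e))
      (\<lambda>s'. s' = (\<lambda>i. if 0 < i \<and> i \<le> Suc n then NIL else s i))"
    unfolding clear.simps
    by (intro runs_Seq runs_mono[OF Suc order_refl] runs_Assign) (auto simp: fun_eq_iff)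
  then show ?case by (rule runs_le) simp
qed

text \<open>The decider is wrapped: its variables are cleared before the run, and its answer is
  replaced by one of two fixed trees afterwards. The latter supplies the size bound on the output,
  which does not follow polynomially from the time bound.\<close>

lemma poly_time_decidable_polyf_on:
  assumes "poly_time_decidable enc A Y"
  obtains dec where "polyf_on (enc ` A) dec" "\<forall>x\<in>A. dec (enc x) \<noteq> NIL \<longleftrightarrow> x \<in> Y"
proof -
  obtain p a d where p: "decides_in_time p enc A Y (\<lambda>x. a * tree_size (enc x) ^ d)"
    using assms unfolding poly_time_decidable_def by blast
  define dec where "dec y = bool_tree (\<exists>x\<in>A. enc x = y \<and> x \<in> Y)" for y
  have ex: "\<exists>t s. exec p (init_store (enc x)) t s \<and> t \<le> a * tree_size (enc x) ^ d \<and>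
      (s 0 \<noteq> NIL \<longleftrightarrow> x \<in> Y)" if "x \<in> A" for x
    using p that unfolding decides_in_time_def by blast
  have dec: "dec (enc x) \<noteq> NIL \<longleftrightarrow> x \<in> Y" if x: "x \<in> A" for x
  proof -
    have "x' \<in> Y \<longleftrightarrow> x \<in> Y" if x': "x' \<in> A" "enc x' = enc x" for x'
    proof -
      obtain t r t' r' where 1: "exec p (init_store (enc x)) t r" "r 0 \<noteq> NIL \<longleftrightarrow> x \<in> Y"
        and 2: "exec p (init_store (enc x')) t' r'" "r' 0 \<noteq> NIL \<longleftrightarrow> x' \<in> Y"
        using ex[OF x] ex[OF x'(1)] by auto
      have "r = r'" by (rule exec_deterministic[OF 1(1) 2(1)[unfolded x'(2)]])
      then show ?thesis using 1 2 by simp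
    qed
    then have "(\<exists>x'\<in>A. enc x' = enc x \<and> x' \<in> Y) \<longleftrightarrow> x \<in> Y" using x by blast
    then show ?thesis by (simp add: dec_def)
  qed
  define N where "N = Suc (com_bound p)"
  let ?out = "If (Var 0) (Assign 0 (Cons_e Nil_e Nil_e)) (Assign 0 Nil_e)"
  let ?p = "Seq (clear N) (Seq p ?out)"
  let ?B = "\<lambda>m. (2 + 2 * N) + (a * m ^ d + 6)"
  have run: "runs ?p s (?B (tree_size (s 0))) (\<lambda>s'. s' 0 = dec (s 0) \<and> (\<forall>i\<ge>Suc N. s' i = s i))"
    if s: "s 0 \<in> enc ` A" for s
  proof -
    obtain x where x: "x \<in> A" "s 0 = enc x" using s by blast
    obtain t r where r: "exec p (init_store (enc x)) t r" "t \<le> a * tree_size (s 0) ^ d"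
        "r 0 \<noteq> NIL \<longleftrightarrow> x \<in> Y" using ex[OF x(1)] x by auto
    let ?s = "\<lambda>i. if 0 < i \<and> i \<le> N then NIL else s i"
    \<comment> \<open>After clearing, the store agrees with the initial one on every variable that
      \<open>p\<close> can access.\<close>
    have "\<forall>i<Suc N. ?s i = init_store (enc x) i" using x by (simp add: init_store_def)
    from exec_agree[OF r(1) _ this] obtain r' where r': "exec p ?s t r'"
        "\<forall>i<Suc N. r' i = r i" "\<forall>i\<ge>Suc N. r' i = ?s i" by (auto simp: N_def)
    have out: "runs ?out r' 6 (\<lambda>s'. s' 0 = dec (s 0) \<and> (\<forall>i\<ge>Suc N. s' i = s i))"
    proof (rule runs_le, rule runs_If[where T = 4])
      have "r' 0 \<noteq> NIL \<longleftrightarrow> dec (s 0) \<noteq> NIL" using r' r x dec by simp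
      moreover have "dec (s 0) = NIL \<or> dec (s 0) = CONS NIL NIL" by (simp add: dec_def bool_tree_def)
      ultimately show "runs (Assign 0 (Cons_e Nil_e Nil_e)) r' 4 (\<lambda>s'. s' 0 = dec (s 0) \<and> (\<forall>i\<ge>Suc N. s' i = s i))"
        if "expr_val (Var 0) r' \<noteq> NIL" using that r'
        by (auto intro!: runs_le[OF runs_Assign])
      show "runs (Assign 0 Nil_e) r' 4 (\<lambda>s'. s' 0 = dec (s 0) \<and> (\<forall>i\<ge>Suc N. s' i = s i))"
        if "expr_val (Var 0) r' = NIL" using that r' \<open>r' 0 \<noteq> NIL \<longleftrightarrow> dec (s 0) \<noteq> NIL\<close>
        by (auto intro!: runs_le[OF runs_Assign])
    qed simp
    have "runs p ?s (a * tree_size (s 0) ^ d)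
        (\<lambda>r'. runs ?out r' 6 (\<lambda>s'. s' 0 = dec (s 0) \<and> (\<forall>i\<ge>Suc N. s' i = s i)))"
      unfolding runs_def[of p] using r' r out by blast
    then show ?thesis by (intro runs_Seq runs_mono[OF runs_clear order_refl]) auto
  qed
  have "polyf_on (enc ` A) dec"
  proof (rule polyf_onI)
    show "poly_bounded ?B" by (intro poly_bounded_intros poly_bounded_power)
    show "subroutine ?p (Suc N) (enc ` A) dec ?B"
      unfolding subroutine_def
    proof (intro conjI allI impI ballI)
      show "tree_size (dec x) \<le> ?B (tree_size x)" for x
        using tree_size_bool_tree[of "\<exists>z\<in>A. enc z = x \<and> z \<in> Y"] by (simp add: dec_def)
    qed (use run in auto)
  qed
  with dec show ?thesis using that by blast
qed

section \<open>Uniform solutions\<close>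

lemma edge_coloredD:
  assumes "edge_colored G" "e \<in> cedges G i"
  shows "i \<in> colors G" "e \<subseteq> verts G" "card e = 2" "e \<in> edges G"
proof -
  show "i \<in> colors G" using assms unfolding edge_colored_def by (metis empty_iff)
  then show "e \<subseteq> verts G" "card e = 2" "e \<in> edges G"
    using assms by (auto simp: edge_colored_def edges_def)
qed

lemma cedges_unique:
  assumes "edge_colored G" "e \<in> cedges G i" "e \<in> cedges G j"
  shows "i = j"
  using assms edge_coloredD(1)[OF assms(1,2)] edge_coloredD(1)[OF assms(1,3)]
  unfolding edge_colored_def by blast

lemma no_loop: "edge_colored G \<Longrightarrow> {u} \<notin> cedges G i"
  using edge_coloredD(3) by fastforce

lemma finite_edges: "edge_colored G \<Longrightarrow> finite (edges G)"
  by (rule finite_subset[of _ "Pow (verts G)"]) (auto simp: edge_colored_def edges_def)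

lemma edges_cases:
  assumes "edge_colored G" "e \<in> edges G"
  obtains u v where "e = {u, v}" "u \<noteq> v" "u \<in> verts G" "v \<in> verts G"
proof -
  obtain i where i: "e \<in> cedges G i" using assms(2) by (auto simp: edges_def)
  obtain u v where "e = {u, v}" "u \<noteq> v"
    using edge_coloredD(3)[OF assms(1) i] by (auto simp: card_2_iff)
  then show ?thesis using edge_coloredD(2)[OF assms(1) i] that by auto
qed

text \<open>The two alternatives in the definition of the relation differ only in how
  \<open>u\<close> and \<open>v\<close> see each other: closed neighborhoods in one color if they
  are joined in that color, open ones otherwise. What remains is a condition on third vertices, free
  of case distinctions.\<close>

lemma nbh_rel_iff:
  assumes G: "edge_colored G"
  shows "(u, v) \<in> nbh_rel G \<longleftrightarrow> u \<in> verts G \<and> v \<in> verts G \<and>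
    (\<forall>w i. w \<noteq> u \<longrightarrow> w \<noteq> v \<longrightarrow> ({w, u} \<in> cedges G i \<longleftrightarrow> {w, v} \<in> cedges G i))"
    (is "?l \<longleftrightarrow> ?r")
proof
  assume ?l
  then have uv: "u \<in> verts G" "v \<in> verts G" and
    *: "(\<exists>i\<in>colors G. closed_nbh G i u = closed_nbh G i v \<and>
                     (\<forall>j\<in>colors G. j \<noteq> i \<longrightarrow> nbh G j u = nbh G j v)) \<or>
      (\<forall>j\<in>colors G. nbh G j u = nbh G j v)"
    by (auto simp: nbh_rel_def)
  have "{w, u} \<in> cedges G i \<longleftrightarrow> {w, v} \<in> cedges G i" if w: "w \<noteq> u" "w \<noteq> v" for w i
  proof (cases "i \<in> colors G")
    case True
    have "nbh G i u = nbh G i v \<or> closed_nbh G i u = closed_nbh G i v" using * True by metis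
    then show ?thesis using w unfolding nbh_def closed_nbh_def by auto
  next
    case False
    then show ?thesis using edge_coloredD(1)[OF G] by blast
  qed
  then show ?r using uv by blast
next
  assume r: ?r
  show ?l
  \<comment> \<open>The color of an edge between \<open>u\<close> and \<open>v\<close>, if there is
    one, is the color whose closed neighborhoods agree.\<close>
  proof (cases "\<exists>i. {u, v} \<in> cedges G i")
    case True
    then obtain i where i: "{u, v} \<in> cedges G i" by blast
    have i': "{v, u} \<in> cedges G i" using i by (simp add: insert_commute)
    have "closed_nbh G i u = closed_nbh G i v"
    proof (rule set_eqI)
      show "w \<in> closed_nbh G i u \<longleftrightarrow> w \<in> closed_nbh G i v" for w
        by (cases "w = u"; cases "w = v") (use r i i' in \<open>auto simp: closed_nbh_def nbh_def\<close>)
    qed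
    moreover have "nbh G j u = nbh G j v" if "j \<noteq> i" for j
    proof -
      have "{u, v} \<notin> cedges G j" "{v, u} \<notin> cedges G j"
        using cedges_unique[OF G i] cedges_unique[OF G i'] that by blast+
      moreover have "{u, u} \<notin> cedges G j" "{v, v} \<notin> cedges G j" using no_loop[OF G] by auto
      ultimately have "w \<in> nbh G j u \<longleftrightarrow> w \<in> nbh G j v" for w
        by (cases "w = u"; cases "w = v") (use r in \<open>auto simp: nbh_def\<close>)
      then show ?thesis by blast
    qed
    moreover have "i \<in> colors G" by (rule edge_coloredD[OF G i])
    ultimately show ?thesis using r unfolding nbh_rel_def by blast
  next
    case False
    then have "{u, v} \<notin> cedges G j" "{v, u} \<notin> cedges G j" for j
      by (auto simp: insert_commute)
    moreover have "{u, u} \<notin> cedges G j" "{v, v} \<notin> cedges G j" for j using no_loop[OF G] by auto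
    ultimately have "w \<in> nbh G j u \<longleftrightarrow> w \<in> nbh G j v" for w j
      by (cases "w = u"; cases "w = v") (use r in \<open>auto simp: nbh_def\<close>)
    then have "nbh G j u = nbh G j v" for j by blast
    then show ?thesis using r unfolding nbh_rel_def by blast
  qed
qed

lemma equiv_nbh_rel:
  assumes G: "edge_colored G"
  shows "equiv (verts G) (nbh_rel G)"
proof (rule equivI)
  show "nbh_rel G \<subseteq> verts G \<times> verts G" by (auto simp: nbh_rel_def)
  show "refl_on (verts G) (nbh_rel G)" by (auto simp: refl_on_def nbh_rel_iff[OF G])
  show "sym (nbh_rel G)" by (auto simp: sym_def nbh_rel_iff[OF G])
  show "trans (nbh_rel G)"
  proof (rule transI)
    fix u v w assume uv: "(u, v) \<in> nbh_rel G" and vw: "(v, w) \<in> nbh_rel G"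
    have "{z, u} \<in> cedges G i \<longleftrightarrow> {z, w} \<in> cedges G i" if z: "z \<noteq> u" "z \<noteq> w" for z i
    proof (cases "z = v")
      case False
      then show ?thesis using uv vw z unfolding nbh_rel_iff[OF G] by blast
    next
      case True
      show ?thesis
      proof (cases "u = w")
        case False
        \<comment> \<open>If the test vertex is the middle vertex \<open>v\<close>, the
          characterization says nothing about it directly. Both \<open>{v, u}\<close> and
          \<open>{v, w}\<close> are then compared with \<open>{u, w}\<close>.\<close>
        have "{w, u} \<in> cedges G i \<longleftrightarrow> {w, v} \<in> cedges G i" "{u, v} \<in> cedges G i \<longleftrightarrow> {u, w} \<in> cedges G i"
          using uv vw z True False unfolding nbh_rel_iff[OF G] by metis+
        then show ?thesis using True by (simp add: insert_commute)
      qed simp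
    qed
    then show "(u, w) \<in> nbh_rel G" using uv vw unfolding nbh_rel_iff[OF G] by blast
  qed
qed

text \<open>Copies become maps from the pattern into the host, so a copy is altered simply by
  changing the map, without handling induced subgraphs.\<close>

lemma contains_induced_iff_embedding:
  "contains_induced G F \<longleftrightarrow> (\<exists>g. inj_on g (verts F) \<and> g ` verts F \<subseteq> verts G \<and>
     (\<forall>x\<in>verts F. \<forall>y\<in>verts F. \<forall>i. {x, y} \<in> cedges F i \<longleftrightarrow> {g x, g y} \<in> cedges G i))"
    (is "?l \<longleftrightarrow> ?r")
proof
  assume ?l
  then obtain W f where W: "W \<subseteq> verts G" and f: "bij_betw f W (verts F)"
    and e: "\<And>u v i. u \<in> W \<Longrightarrow> v \<in> W \<Longrightarrow> {u, v} \<in> cedges G i \<longleftrightarrow> {f u, f v} \<in> cedges F i"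
    by (auto simp: contains_induced_def isomorphic_def induced_def)
  let ?g = "inv_into W f"
  have g: "bij_betw ?g (verts F) W" by (rule bij_betw_inv_into[OF f])
  have fg: "f (?g x) = x" "?g x \<in> W" if "x \<in> verts F" for x
    using that f by (auto simp: bij_betw_def f_inv_into_f inv_into_into)
  show ?r
  proof (intro exI[of _ ?g] conjI ballI allI)
    show "inj_on ?g (verts F)" "?g ` verts F \<subseteq> verts G" using g W by (auto simp: bij_betw_def)
    show "{x, y} \<in> cedges F i \<longleftrightarrow> {?g x, ?g y} \<in> cedges G i"
      if "x \<in> verts F" "y \<in> verts F" for x y i
      using e[of "?g x" "?g y" i] fg that by simp
  qed
next
  assume ?r
  then obtain g where g: "inj_on g (verts F)" "g ` verts F \<subseteq> verts G"
    and e: "\<forall>x\<in>verts F. \<forall>y\<in>verts F. \<forall>i. {x, y} \<in> cedges F i \<longleftrightarrow> {g x, g y} \<in> cedges G i"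
    by (elim exE conjE)
  let ?W = "g ` verts F" and ?f = "inv_into (verts F) g"
  have f: "bij_betw ?f ?W (verts F)" using g by (simp add: bij_betw_inv_into inj_on_imp_bij_betw)
  have "{u, v} \<in> cedges (induced G ?W) i \<longleftrightarrow> {?f u, ?f v} \<in> cedges F i"
    if "u \<in> ?W" "v \<in> ?W" for u v i
    using e[rule_format, of "?f u" "?f v" i] that
    by (simp add: induced_def f_inv_into_f inv_into_into)
  then show ?l using f g unfolding contains_induced_def isomorphic_def
    by (intro exI[of _ ?W]) (auto simp: induced_def)
qed

section \<open>Making a solution uniform\<close>

definition free_after :: "'w ecgraph set \<Rightarrow> 'v ecgraph \<Rightarrow> 'v set set \<Rightarrow> bool" where
  "free_after \<F> G S \<longleftrightarrow> (\<forall>F\<in>\<F>. \<not> contains_induced (delete_edges G S) F)"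

text \<open>The instance \<open>u = v\<close> forbids edges of \<open>S\<close> inside
  \<open>C\<close>; the other instances say that all vertices of \<open>C\<close> have the same
  partners in \<open>S\<close>.\<close>

definition uniform_on :: "'v set set \<Rightarrow> 'v set \<Rightarrow> bool" where
  "uniform_on S C \<longleftrightarrow> (\<forall>u\<in>C. \<forall>v\<in>C. \<forall>w. {w, u} \<in> S \<longleftrightarrow> w \<notin> C \<and> {w, v} \<in> S)"

text \<open>The twin relation pulls back along the embedding: by injectivity a third vertex of
  \<open>F\<close> is mapped to a third vertex of \<open>G\<close>, and neither the colors of
  \<open>G\<close> nor \<open>S\<close> distinguish the two images. Two preimages in
  \<open>C\<close> would thus be twins in \<open>F\<close>.\<close>

lemma embedding_class_unique:
  assumes G: "edge_colored G" and F: "edge_colored F" "color_diverse F"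
    and C: "C \<in> nbh_classes G" and S: "uniform_on S C"
    and inj: "inj_on g (verts F)"
    and emb: "\<And>x y i. x \<in> verts F \<Longrightarrow> y \<in> verts F \<Longrightarrow>
      {x, y} \<in> cedges F i \<longleftrightarrow> {g x, g y} \<in> cedges G i \<and> {g x, g y} \<notin> S"
    and xy: "x \<in> verts F" "y \<in> verts F" "g x \<in> C" "g y \<in> C"
  shows "x = y"
proof (rule ccontr)
  assume "x \<noteq> y"
  have tw: "(g x, g y) \<in> nbh_rel G"
    using quotient_eq_iff[OF equiv_nbh_rel[OF G] C[unfolded nbh_classes_def] C[unfolded nbh_classes_def] xy(3,4)]
    by simp
  have "{w, x} \<in> cedges F i \<longleftrightarrow> {w, y} \<in> cedges F i" if w: "w \<noteq> x" "w \<noteq> y" for w i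
  proof (cases "w \<in> verts F")
    case True
    then have "g w \<noteq> g x" "g w \<noteq> g y" using inj w xy by (auto dest: inj_onD)
    then have "{g w, g x} \<in> cedges G i \<longleftrightarrow> {g w, g y} \<in> cedges G i"
      using tw unfolding nbh_rel_iff[OF G] by blast
    moreover have "{g w, g x} \<in> S \<longleftrightarrow> {g w, g y} \<in> S"
      using S xy unfolding uniform_on_def by blast
    ultimately show ?thesis using emb True xy by simp
  next
    case False
    then show ?thesis using edge_coloredD(2)[OF F(1)] by blast
  qed
  then have "(x, y) \<in> nbh_rel F" using xy unfolding nbh_rel_iff[OF F(1)] by blast
  then have "y \<in> nbh_rel F `` {x}" by blast
  moreover have "x \<in> nbh_rel F `` {x}"
    using equiv_class_self[OF equiv_nbh_rel[OF F(1)] xy(1)] .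
  moreover have "card (nbh_rel F `` {x}) = 1"
    using F(2) xy unfolding color_diverse_def nbh_classes_def by (auto intro: quotientI)
  ultimately show False using \<open>x \<noteq> y\<close> by (metis card_1_singletonE singletonD)
qed

text \<open>The last conclusion is what allows the classes to be treated one after another: making
  \<open>C\<close> uniform does not destroy the uniformity already reached elsewhere.\<close>

lemma uniformize_class:
  assumes G: "edge_colored G" and \<F>: "\<And>F. F \<in> \<F> \<Longrightarrow> edge_colored F \<and> color_diverse F"
    and C: "C \<in> nbh_classes G" and S: "S \<subseteq> edges G" "free_after \<F> G S"
  obtains S' where "S' \<subseteq> edges G" "free_after \<F> G S'" "card S' \<le> card S" "uniform_on S' C"
    "\<And>D. D \<in> nbh_classes G \<Longrightarrow> uniform_on S D \<Longrightarrow> uniform_on S' D"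
proof -
  note eq = equiv_nbh_rel[OF G]
  have CV: "C \<subseteq> verts G" "C \<noteq> {}" using C in_quotient_imp_subset[OF eq] in_quotient_imp_non_empty[OF eq]
    by (auto simp: nbh_classes_def)
  have fin: "finite (verts G)" "finite C" "finite S"
    using G CV S finite_edges[OF G] by (auto simp: edge_colored_def intro: finite_subset)
  have tw: "(u, v) \<in> nbh_rel G" if "u \<in> C" "v \<in> C" for u v
    using quotient_eq_iff[OF eq C[unfolded nbh_classes_def] C[unfolded nbh_classes_def] that]
    by simp
  define out where "out v = {w \<in> verts G - C. {w, v} \<in> S}" for v
  have out_fin: "finite (out v)" for v using fin by (simp add: out_def)
  obtain z where z: "z \<in> C" "\<And>v. v \<in> C \<Longrightarrow> card (out z) \<le> card (out v)"
    using CV(2) ex_min_if_finite[of "(\<lambda>v. card (out v)) ` C"] fin(2)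
    by (metis (no_types, lifting) arg_min_if_finite(1) arg_min_least)
  define P where "P = {e \<in> S. e \<inter> C = {}}"
  \<comment> \<open>Edges of \<open>S\<close> avoiding \<open>C\<close> stay, those inside
    \<open>C\<close> are dropped, and the partners of \<open>z\<close> outside \<open>C\<close> are
    given to every vertex of \<open>C\<close>.\<close>
  define S' where "S' = P \<union> (\<lambda>(v, w). {w, v}) ` (C \<times> out z)"
  have S_verts: "u \<in> verts G" "v \<in> verts G" "u \<noteq> v" if "{u, v} \<in> S" for u v
    using that S edges_cases[OF G, of "{u, v}"] by (auto simp: doubleton_eq_iff)
  have mem0: "{w, u} \<in> S' \<longleftrightarrow> {w, u} \<in> S" if "u \<notin> C" "w \<notin> C" for u w
    using that unfolding S'_def P_def out_def by (auto simp: doubleton_eq_iff)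
  have mem1: "{w, u} \<in> S' \<longleftrightarrow> w \<notin> C \<and> {w, z} \<in> S" if "u \<in> C" for u w
    using that z(1) S_verts unfolding S'_def P_def out_def by (auto simp: doubleton_eq_iff image_iff)
  show thesis
  proof
    show unif: "uniform_on S' C" unfolding uniform_on_def using mem1 by blast
    show "S' \<subseteq> edges G"
    proof -
      \<comment> \<open>Only existing edges are deleted: \<open>v\<close> is a twin of
        \<open>z\<close>, and \<open>w\<close> is a third vertex adjacent to
        \<open>z\<close>.\<close>
      have "{w, v} \<in> edges G" if "v \<in> C" "w \<in> out z" for v w
      proof -
        have "w \<notin> C" "{w, z} \<in> edges G" using that S by (auto simp: out_def)
        moreover have "w \<noteq> v" "w \<noteq> z" using that z by (auto simp: out_def)
        ultimately show ?thesis using tw[OF that(1) z(1)] unfolding nbh_rel_iff[OF G] edges_def by blast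
      qed
      then show ?thesis using S by (auto simp: S'_def P_def)
    qed
    show "card S' \<le> card S"
    proof -
      have "card ((\<lambda>(v, w). {w, v}) ` (C \<times> out z)) \<le> card (C \<times> out z)"
        using fin out_fin by (intro card_image_le) auto
      also have "\<dots> = (\<Sum>v\<in>C. card (out z))" by (simp add: card_cartesian_product)
      also have "\<dots> \<le> (\<Sum>v\<in>C. card (out v))" by (intro sum_mono z)
      also have "\<dots> = card (Sigma C out)" using fin out_fin by (simp add: card_SigmaI)
      \<comment> \<open>A pair in \<open>Sigma C out\<close> is determined by its edge, because
        exactly one endpoint of that edge lies in \<open>C\<close>.\<close>
      also have "\<dots> = card ((\<lambda>(v, w). {w, v}) ` Sigma C out)"
        by (intro card_image[symmetric]) (auto simp: inj_on_def out_def doubleton_eq_iff)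
      finally have le: "card ((\<lambda>(v, w). {w, v}) ` (C \<times> out z)) \<le> card ((\<lambda>(v, w). {w, v}) ` Sigma C out)" .
      have "card S' \<le> card P + card ((\<lambda>(v, w). {w, v}) ` (C \<times> out z))"
        unfolding S'_def by (rule card_Un_le)
      also have "\<dots> \<le> card P + card ((\<lambda>(v, w). {w, v}) ` Sigma C out)" using le by simp
      also have "\<dots> = card (P \<union> (\<lambda>(v, w). {w, v}) ` Sigma C out)"
        using fin out_fin by (intro card_Un_disjoint[symmetric]) (auto simp: P_def)
      also have "\<dots> \<le> card S"
        using fin by (intro card_mono) (auto simp: P_def out_def)
      finally show ?thesis .
    qed
    show "uniform_on S' D" if D: "D \<in> nbh_classes G" "uniform_on S D" for D
    proof (cases "D = C")
      case False
      then have disj: "D \<inter> C = {}"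
        using quotient_disj[OF eq] C D by (auto simp: nbh_classes_def)
      show ?thesis unfolding uniform_on_def
      proof (intro ballI allI)
        fix u v w assume uv: "u \<in> D" "v \<in> D"
        have nC: "u \<notin> C" "v \<notin> C" "z \<notin> D" using uv disj z by auto
        show "{w, u} \<in> S' \<longleftrightarrow> w \<notin> D \<and> {w, v} \<in> S'"
        \<comment> \<open>For \<open>w\<close> in \<open>C\<close>, membership in \<open>S'\<close>
          is decided by \<open>z\<close> in place of \<open>w\<close>, and \<open>S\<close> does not
          let \<open>z\<close> distinguish vertices of the uniform class \<open>D\<close>.\<close>
        proof (cases "w \<in> C")
          case True
          then have "{w, u} \<in> S' \<longleftrightarrow> {z, u} \<in> S" "{w, v} \<in> S' \<longleftrightarrow> {z, v} \<in> S" "w \<notin> D"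
            using mem1[of w u] mem1[of w v] nC disj by (auto simp: insert_commute)
          then show ?thesis using D(2) uv nC unfolding uniform_on_def by blast
        next
          case False
          then show ?thesis using mem0[of _ w] nC D(2) uv unfolding uniform_on_def by blast
        qed
      qed
    qed (use unif in simp)
    show "free_after \<F> G S'" unfolding free_after_def
    proof
      fix F assume F: "F \<in> \<F>"
      show "\<not> contains_induced (delete_edges G S') F"
      proof
        assume "contains_induced (delete_edges G S') F"
        then obtain g where g: "inj_on g (verts F)" "g ` verts F \<subseteq> verts G"
          and e: "\<And>x y i. x \<in> verts F \<Longrightarrow> y \<in> verts F \<Longrightarrow>
            {x, y} \<in> cedges F i \<longleftrightarrow> {g x, g y} \<in> cedges G i \<and> {g x, g y} \<notin> S'"
          unfolding contains_induced_iff_embedding delete_edges_def by auto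
        have one: "x = y" if "x \<in> verts F" "y \<in> verts F" "g x \<in> C" "g y \<in> C" for x y
          using embedding_class_unique[OF G _ _ C unif g(1) e that] \<F>[OF F] by blast
        define h where "h x = (if g x \<in> C then z else g x)" for x
        have "inj_on h (verts F)"
        proof (rule inj_onI)
          fix x y assume "x \<in> verts F" "y \<in> verts F" "h x = h y"
          then show "x = y" using one[of x y] g(1) z(1) by (auto simp: h_def inj_on_def split: if_splits)
        qed
        moreover have "h ` verts F \<subseteq> verts G" using g(2) z(1) CV by (auto simp: h_def)
        moreover have "{x, y} \<in> cedges F i \<longleftrightarrow> {h x, h y} \<in> cedges G i \<and> {h x, h y} \<notin> S"
          if xy: "x \<in> verts F" "y \<in> verts F" for x y i
        proof (cases "x = y")
          case True
          then show ?thesis using no_loop[OF G] e[OF xy] by simp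
        next
          case False
          \<comment> \<open>At most one endpoint lies in \<open>C\<close>. With \<open>g x\<close>
            outside, passing from \<open>g y\<close> to its twin \<open>z\<close> preserves colors,
            and \<open>S\<close> at \<open>z\<close> is by construction what \<open>S'\<close> is at
            \<open>g y\<close>.\<close>
          have swap: "{h x, h y} \<in> cedges G i \<and> {h x, h y} \<notin> S \<longleftrightarrow>
              {g x, g y} \<in> cedges G i \<and> {g x, g y} \<notin> S'"
            if xy: "x \<in> verts F" "y \<in> verts F" "g x \<notin> C" for x y
          proof (cases "g y \<in> C")
            case True
            then have "g x \<noteq> g y" "g x \<noteq> z" using xy z(1) by auto
            then have "{g x, g y} \<in> cedges G i \<longleftrightarrow> {g x, z} \<in> cedges G i"
              using tw[OF True z(1)] unfolding nbh_rel_iff[OF G] by blast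
            then show ?thesis using mem1[OF True, of "g x"] xy True by (simp add: h_def)
          next
            case False
            then show ?thesis using mem0[OF False, of "g x"] xy by (simp add: h_def)
          qed
          consider "g x \<notin> C" | "g y \<notin> C" using one[OF xy] False by blast
          then show ?thesis
          proof cases
            case 1
            then show ?thesis using swap[OF xy 1] e[OF xy] by simp
          next
            case 2
            then show ?thesis using swap[OF xy(2,1) 2] e[OF xy] by (simp add: insert_commute)
          qed
        qed
        ultimately have "contains_induced (delete_edges G S) F"
          unfolding contains_induced_iff_embedding delete_edges_def by auto
        then show False using S(2) F by (simp add: free_after_def)
      qed
    qed
  qed
qed

text \<open>Induction over the set of classes already made uniform.\<close>

lemma uniform_solution:
  assumes G: "edge_colored G" and \<F>: "\<And>F. F \<in> \<F> \<Longrightarrow> edge_colored F \<and> color_diverse F"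
    and S: "S \<subseteq> edges G" "free_after \<F> G S"
  obtains S' where "S' \<subseteq> edges G" "free_after \<F> G S'" "card S' \<le> card S"
    "\<And>C. C \<in> nbh_classes G \<Longrightarrow> uniform_on S' C"
proof -
  have fin: "finite (nbh_classes G)"
    using G equiv_nbh_rel[OF G]
    by (auto simp: nbh_classes_def edge_colored_def nbh_rel_def intro: finite_quotient)
  have "\<exists>S'\<subseteq>edges G. free_after \<F> G S' \<and> card S' \<le> card S \<and> (\<forall>C\<in>\<C>. uniform_on S' C)"
    if "finite \<C>" "\<C> \<subseteq> nbh_classes G" for \<C>
    using that
  proof (induction \<C> rule: finite_induct)
    case empty
    then show ?case using S by blast
  next
    case (insert C \<C>)
    then obtain S' where S': "S' \<subseteq> edges G" "free_after \<F> G S'" "card S' \<le> card S"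
      "\<forall>C\<in>\<C>. uniform_on S' C" by auto
    obtain S'' where "S'' \<subseteq> edges G" "free_after \<F> G S''" "card S'' \<le> card S'" "uniform_on S'' C"
      "\<And>D. D \<in> nbh_classes G \<Longrightarrow> uniform_on S' D \<Longrightarrow> uniform_on S'' D"
      using uniformize_class[OF G \<F> _ S'(1,2)] insert.prems by blast
    then show ?case using S' insert.prems by (intro exI[of _ S'']) auto
  qed
  from this[OF fin order_refl] show thesis using that by blast
qed

section \<open>The algorithm\<close>

lemma polyf_comp2:
  assumes "polyf (\<lambda>y. f (head y) (tail y))" "polyf a" "polyf b"
  shows "polyf (\<lambda>x. f (a x) (b x))"
  using polyf_comp[OF assms(1) polyf_CONS[OF assms(2,3)]] by simp

lemma polyp_comp3:
  assumes "polyp (\<lambda>y. f (head y) (head (tail y)) (tail (tail y)))" "polyf a" "polyf b" "polyf c"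
  shows "polyp (\<lambda>x. f (a x) (b x) (c x))"
  using polyp_comp[OF assms(1) polyf_CONS[OF assms(2) polyf_CONS[OF assms(3,4)]]] by simp

lemma polyp_comp4:
  assumes "polyp (\<lambda>y. f (head y) (head (tail y)) (head (tail (tail y))) (tail (tail (tail y))))"
    "polyf a" "polyf b" "polyf c" "polyf d"
  shows "polyp (\<lambda>x. f (a x) (b x) (c x) (d x))"
  using polyp_comp[OF assms(1) polyf_CONS[OF assms(2) polyf_CONS[OF assms(3) polyf_CONS[OF assms(4,5)]]]]
  by simp

text \<open>Unary numbers are equal if both truncated differences vanish.\<close>

definition eq_nat_tree :: "tree \<Rightarrow> tree \<Rightarrow> bool" where
  "eq_nat_tree a b \<longleftrightarrow> drop_tree a b = NIL \<and> drop_tree b a = NIL"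

definition entry :: "tree \<Rightarrow> tree \<Rightarrow> tree \<Rightarrow> tree" where
  "entry g u v = head (drop_tree (head (drop_tree g u)) v)"

text \<open>This is \<open>0, \<dots>, n - 1\<close> in unary. The rows of the matrix serve only as
  a counter: each one increments all numbers found so far and prepends 0.\<close>

definition vertex_list :: "tree \<Rightarrow> tree" where
  "vertex_list g = foldr (\<lambda>a acc. CONS NIL (enc_list (map (CONS NIL) (lst acc)))) (lst g) NIL"

definition twin :: "tree \<Rightarrow> tree \<Rightarrow> tree \<Rightarrow> bool" where
  "twin g u v \<longleftrightarrow> (\<forall>w\<in>set (lst (vertex_list g)). eq_nat_tree w u \<or> eq_nat_tree w v \<or> eq_nat_tree (entry g u w) (entry g v w))"

text \<open>The condition \<open>drop_tree u w \<noteq> NIL\<close> means that \<open>w\<close> is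
  smaller than \<open>u\<close>, so exactly the least vertex of each class is kept.\<close>

definition reps :: "tree \<Rightarrow> tree" where
  "reps g = enc_list (filter (\<lambda>u. \<not> (\<exists>w\<in>set (lst (vertex_list g)). drop_tree u w \<noteq> NIL \<and> twin g w u)) (lst (vertex_list g)))"

definition pairs :: "tree \<Rightarrow> tree" where
  "pairs l = enc_list (concat (map lst (lst
     (enc_list (map (\<lambda>r. enc_list (map (\<lambda>r'. CONS r r') (lst l))) (lst l))))))"

text \<open>An element of \<open>B\<close> is a bit followed by an ordered pair of representatives.
  Edges are unordered, so a set bit acts in both directions.\<close>

definition deleted :: "tree \<Rightarrow> tree \<Rightarrow> tree \<Rightarrow> tree \<Rightarrow> bool" where
  "deleted g B u v \<longleftrightarrow> (\<exists>q\<in>set (lst B). head q \<noteq> NIL \<and>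
     (twin g u (head (tail q)) \<and> twin g v (tail (tail q)) \<or>
      twin g u (tail (tail q)) \<and> twin g v (head (tail q))))"

text \<open>The color classes of the remaining graph may be empty. Colors above \<open>c\<close> do not occur in
  \<open>\<F>\<close>, so merging them into color \<open>c + 1\<close> does not change which members of \<open>\<F>\<close> are contained;
  if one of the colors \<open>1, \<dots>, c\<close> is missing, then no member of \<open>\<F>\<close> is contained.
  In this way the decider for \<open>\<F>\<close> is only run on graphs without empty color classes.\<close>

definition reduced_matrix :: "nat \<Rightarrow> tree \<Rightarrow> tree \<Rightarrow> tree" where
  "reduced_matrix c g B = enc_list (map (\<lambda>u. enc_list (map (\<lambda>v.
     if deleted g B u v then NIL
     else if drop_tree (entry g u v) (enc_nat c) = NIL then entry g u v
     else enc_nat (Suc c)) (lst (vertex_list g)))) (lst (vertex_list g)))"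

text \<open>The length of the list is the number of deleted edges, that is, a unary number up to its
  entries. The first test asks for \<open>head q\<close> to be smaller than \<open>tail q\<close>,
  so that each edge is listed once.\<close>

definition cost :: "tree \<Rightarrow> tree \<Rightarrow> tree" where
  "cost g B = enc_list (filter (\<lambda>q. drop_tree (tail q) (head q) \<noteq> NIL \<and>
     entry g (head q) (tail q) \<noteq> NIL \<and> deleted g B (head q) (tail q)) (lst (pairs (vertex_list g))))"

text \<open>The detour through \<open>enc_list\<close> gives the quantifier over colors the shape to
  which \<open>polyp_ball\<close> applies.\<close>

definition present :: "nat \<Rightarrow> tree \<Rightarrow> bool" where
  "present c M \<longleftrightarrow> (\<forall>i\<in>set (lst (enc_list (map enc_nat [1..<Suc c]))).
     \<exists>row\<in>set (lst M). \<exists>e\<in>set (lst row). eq_nat_tree e i)"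

text \<open>Binary increment with the most significant bit first. The right fold carries from the
  end of the list, the initial carry is the 1 to be added, and the carry remaining in front signals
  overflow.\<close>

definition increment :: "tree \<Rightarrow> tree" where
  "increment B = foldr (\<lambda>q acc. CONS (bool_tree (head acc \<noteq> NIL \<and> head q \<noteq> NIL))
     (CONS (CONS (bool_tree ((head q \<noteq> NIL) \<noteq> (head acc \<noteq> NIL))) (tail q)) (tail acc)))
     (lst B) (CONS (bool_tree True) NIL)"

text \<open>A state consists of a flag that is \<open>NIL\<close> when the enumeration is finished, the answer found so
  far, the list of pairs of representatives with their bits, the sign, the graph and the
  truncated budget.\<close>

definition query :: "nat \<Rightarrow> tree \<Rightarrow> tree" where
  "query c x = (if present c (reduced_matrix c (head (tail (tail (tail (tail x))))) (head (tail (tail x))))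
     then reduced_matrix c (head (tail (tail (tail (tail x))))) (head (tail (tail x))) else NIL)"

definition accept :: "nat \<Rightarrow> tree \<Rightarrow> tree \<Rightarrow> bool" where
  "accept c r x \<longleftrightarrow> head (tail (tail (tail x))) = NIL \<and>
     drop_tree (cost (head (tail (tail (tail (tail x))))) (head (tail (tail x))))
       (tail (tail (tail (tail (tail x))))) = NIL \<and>
     (\<not> present c (reduced_matrix c (head (tail (tail (tail (tail x))))) (head (tail (tail x)))) \<or> r = NIL)"

text \<open>The decider's answer enters as the argument \<open>r\<close>. Thus the function is total
  and polynomial by the closure rules alone, and the call of the partial decider is composed with it
  separately.\<close>

definition next_state :: "nat \<Rightarrow> tree \<Rightarrow> tree \<Rightarrow> tree" where
  "next_state c r x = CONS (bool_tree (head (increment (head (tail (tail x)))) = NIL))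
     (CONS (bool_tree (head (tail x) \<noteq> NIL \<or> accept c r x))
       (CONS (tail (increment (head (tail (tail x))))) (tail (tail (tail x)))))"

definition first_state :: "tree \<Rightarrow> tree" where
  "first_state y = CONS (bool_tree True) (CONS (bool_tree False)
     (CONS (enc_list (map (\<lambda>p. CONS NIL p) (lst (pairs (reps (head (tail y))))))) y))"

section \<open>The operations run in polynomial time\<close>

lemma polyp_eq_nat_tree: "polyf a \<Longrightarrow> polyf b \<Longrightarrow> polyp (\<lambda>x. eq_nat_tree (a x) (b x))"
  unfolding eq_nat_tree_def by (intro polyf_intros polyf_drop_tree)

lemma polyf_entry: "polyf g \<Longrightarrow> polyf u \<Longrightarrow> polyf v \<Longrightarrow> polyf (\<lambda>x. entry (g x) (u x) (v x))"
  unfolding entry_def by (intro polyf_intros polyf_drop_tree)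

lemma tree_size_enc_nat: "tree_size (enc_nat n) = 2 * n + 1"
  by (induction n) auto

lemma foldr_vertex_list:
  "foldr (\<lambda>a acc. CONS NIL (enc_list (map (CONS NIL) (lst acc)))) ys NIL
    = enc_list (map enc_nat [0..<length ys])"
proof (induction ys)
  case (Cons a ys)
  have "map enc_nat [0..<Suc n] = NIL # map (CONS NIL) (map enc_nat [0..<n])" for n
    by (simp add: upt_conv_Cons del: upt_Suc flip: map_Suc_upt)
  then show ?case using Cons by (simp del: upt_Suc map_map)
qed simp

lemma polyf_vertex_list:
  assumes "polyf g"
  shows "polyf (\<lambda>x. vertex_list (g x))"
proof -
  obtain p N G where G: "poly_bounded G" "subroutine p N UNIV g G"
    using polyf_onE[OF assms] by blast
  show ?thesis unfolding vertex_list_def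
  proof (rule polyf_foldr[OF _ polyf_on_const assms])
    show "polyf (\<lambda>y. CONS NIL (enc_list (map (CONS NIL) (lst (head (tail y))))))"
      by (intro polyf_intros polyf_map)
    show "poly_bounded (\<lambda>m. 1 + G m * (2 * G m + 2))"
      by (intro poly_bounded_intros G)
    fix x ys zs assume *: "lst (g x) = zs @ ys"
    then have len: "length ys \<le> G (tree_size x)"
      using length_lst_le[of "g x"] subroutine_size[OF G(2), of x] by simp
    have "tree_size (enc_list (map enc_nat [0..<length ys])) \<le> 1 + (\<Sum>i\<leftarrow>[0..<length ys]. 2 * length ys + 2)"
      unfolding tree_size_enc_list map_map o_def
      by (intro add_left_mono sum_list_mono) (auto simp: tree_size_enc_nat)
    also have "\<dots> = 1 + length ys * (2 * length ys + 2)" by (simp add: sum_list_triv)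
    also have "\<dots> \<le> 1 + G (tree_size x) * (2 * G (tree_size x) + 2)"
      using len by (intro add_left_mono mult_mono) auto
    finally show "tree_size (foldr (\<lambda>a acc. CONS NIL (enc_list (map (CONS NIL) (lst acc)))) ys NIL)
        \<le> 1 + G (tree_size x) * (2 * G (tree_size x) + 2)"
      by (simp only: foldr_vertex_list)
  qed
qed

lemma polyp_twin: "polyf g \<Longrightarrow> polyf u \<Longrightarrow> polyf v \<Longrightarrow> polyp (\<lambda>x. twin (g x) (u x) (v x))"
  by (rule polyp_comp3[of twin], unfold twin_def)
    (intro polyf_intros polyp_ball polyp_eq_nat_tree polyf_entry polyf_vertex_list)

lemma polyf_reps: "polyf (\<lambda>g. reps g)"
  unfolding reps_def by (intro polyf_intros polyf_filter polyp_bex polyf_drop_tree polyp_twin polyf_vertex_list)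

lemma polyf_pairs: "polyf (\<lambda>l. pairs l)"
  unfolding pairs_def by (intro polyf_intros polyf_concat polyf_map)

lemma polyp_deleted:
  "polyf g \<Longrightarrow> polyf B \<Longrightarrow> polyf u \<Longrightarrow> polyf v \<Longrightarrow> polyp (\<lambda>x. deleted (g x) (B x) (u x) (v x))"
  by (rule polyp_comp4[of deleted], unfold deleted_def) (intro polyf_intros polyp_bex polyp_twin)

lemma polyf_reduced_matrix: "polyf g \<Longrightarrow> polyf B \<Longrightarrow> polyf (\<lambda>x. reduced_matrix c (g x) (B x))"
  by (rule polyf_comp2[of "reduced_matrix c"], unfold reduced_matrix_def)
    (intro polyf_intros polyf_map polyf_vertex_list polyp_deleted polyf_entry polyf_drop_tree)

lemma polyf_cost: "polyf g \<Longrightarrow> polyf B \<Longrightarrow> polyf (\<lambda>x. cost (g x) (B x))"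
  by (rule polyf_comp2[of cost], unfold cost_def)
    (intro polyf_intros polyf_filter polyf_vertex_list polyp_deleted polyf_entry polyf_drop_tree
      polyf_comp[OF polyf_pairs])

lemma polyp_present: "polyp (\<lambda>M. present c M)"
  unfolding present_def by (intro polyp_ball polyp_bex polyp_eq_nat_tree polyf_intros)

lemma polyf_increment: "polyf (\<lambda>B. increment B)"
  unfolding increment_def
proof (rule polyf_foldr[OF _ polyf_on_const polyf_on_id])
  let ?h = "\<lambda>q acc. CONS (bool_tree (head acc \<noteq> NIL \<and> head q \<noteq> NIL))
     (CONS (CONS (bool_tree ((head q \<noteq> NIL) \<noteq> (head acc \<noteq> NIL))) (tail q)) (tail acc))"
  show "polyf (\<lambda>y. ?h (head y) (head (tail y)))"
    by (intro polyf_intros)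
  show "poly_bounded (\<lambda>m. 5 + 7 * m)" by (intro poly_bounded_intros)
  fix x ys zs assume *: "lst x = zs @ ys"
  \<comment> \<open>The second conjunct omits the current carry and reserves 3, the largest size of
    a carry, for the one that replaces it in the next step.\<close>
  have "tree_size (foldr ?h ys (CONS (bool_tree True) NIL)) \<le> 5 + (\<Sum>y\<leftarrow>ys. tree_size y + 6) \<and>
      3 + tree_size (tail (foldr ?h ys (CONS (bool_tree True) NIL))) \<le> 5 + (\<Sum>y\<leftarrow>ys. tree_size y + 6)"
  proof (induction ys)
    case (Cons q ys)
    then show ?case
      using tree_size_tail_le[of q]
        tree_size_bool_tree[of "head (foldr ?h ys (CONS (bool_tree True) NIL)) \<noteq> NIL \<and> head q \<noteq> NIL"]
        tree_size_bool_tree[of "(head q \<noteq> NIL) \<noteq> (head (foldr ?h ys (CONS (bool_tree True) NIL)) \<noteq> NIL)"]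
      by auto
  qed (simp add: bool_tree_def)
  moreover have "(\<Sum>y\<leftarrow>ys. tree_size y + 6) \<le> 7 * (\<Sum>y\<leftarrow>ys. tree_size y + 1)"
    by (induction ys) auto
  moreover have "(\<Sum>y\<leftarrow>ys. tree_size y + 1) \<le> tree_size x"
    using tree_size_lst[of x] * by simp
  ultimately show "tree_size (foldr ?h ys (CONS (bool_tree True) NIL)) \<le> 5 + 7 * tree_size x" by linarith
qed

lemma polyf_query: "polyf (\<lambda>x. query c x)"
  unfolding query_def by (intro polyf_intros polyp_comp[OF polyp_present] polyf_reduced_matrix)

lemma polyf_next_state: "polyf (\<lambda>y. next_state c (head y) (tail y))"
  unfolding next_state_def accept_def
  by (intro polyf_intros polyp_comp[OF polyp_present] polyf_comp[OF polyf_increment] polyf_reduced_matrix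
      polyf_cost polyf_drop_tree)

lemma polyf_first_state: "polyf (\<lambda>y. first_state y)"
  unfolding first_state_def
  by (intro polyf_CONS polyf_on_const polyf_map polyf_intros polyf_comp[OF polyf_pairs]
      polyf_comp[OF polyf_reps])

section \<open>Correctness\<close>

lemma drop_tree_eq: "drop_tree x y = enc_list (drop (length (lst y)) (lst x))"
proof -
  have t: "lst (tail x) = drop 1 (lst x)" for x by (cases x) auto
  have "foldl (\<lambda>acc a. tail acc) x ys = enc_list (drop (length ys) (lst x))" for ys :: "tree list" and x
    by (induction ys arbitrary: x) (auto simp: t)
  then show ?thesis by (simp add: drop_tree_def)
qed

lemma lst_enc_nat [simp]: "lst (enc_nat k) = replicate k NIL"
  by (induction k) auto

lemma enc_list_replicate: "enc_list (replicate k NIL) = enc_nat k"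
  by (induction k) auto

lemma drop_tree_enc_nat [simp]: "drop_tree (enc_nat a) (enc_nat b) = enc_nat (a - b)"
  by (simp add: drop_tree_eq enc_list_replicate)

lemma enc_nat_eq_NIL [simp]: "enc_nat k = NIL \<longleftrightarrow> k = 0"
  by (cases k) auto

lemma enc_list_eq_NIL [simp]: "enc_list xs = NIL \<longleftrightarrow> xs = []"
  by (cases xs) auto

lemma eq_nat_tree_enc_nat [simp]: "eq_nat_tree (enc_nat a) (enc_nat b) \<longleftrightarrow> a = b"
  by (auto simp: eq_nat_tree_def)

lemma head_drop_tree_enc_list: "k < length xs \<Longrightarrow> head (drop_tree (enc_list xs) (enc_nat k)) = xs ! k"
  by (simp add: drop_tree_eq flip: Cons_nth_drop_Suc)

lemma product_map_map:
  "List.product (map f xs) (map f xs) = map (\<lambda>(a, b). (f a, f b)) (List.product xs xs)"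
  by (simp add: product_concat_map map_concat o_def)

lemma lst_pairs: "lst (pairs l) = map (\<lambda>(r, r'). CONS r r') (List.product (lst l) (lst l))"
  by (simp add: pairs_def product_concat_map map_concat o_def)

text \<open>Colors start at 1, which leaves 0 for non-adjacency, and disjointness of the classes
  makes the color of an edge unique. So the matrix determines all color classes.\<close>

lemma cedges_iff_pair_color:
  assumes G: "edge_colored G"
  shows "{u, v} \<in> cedges G i \<longleftrightarrow> i \<noteq> 0 \<and> pair_color G u v = i"
proof -
  have eq: "pair_color G u v = j \<and> j \<noteq> 0" if "{u, v} \<in> cedges G j" for j
  proof -
    have "(THE i. {u, v} \<in> cedges G i) = j"
      using that by (rule the_equality) (rule cedges_unique[OF G _ that])
    then show ?thesis
      using edge_coloredD(1,4)[OF G that] by (simp add: pair_color_def colors_def)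
  qed
  show ?thesis
  proof
    assume "i \<noteq> 0 \<and> pair_color G u v = i"
    then have "{u, v} \<in> edges G" "pair_color G u v = i" by (auto simp: pair_color_def split: if_splits)
    then show "{u, v} \<in> cedges G i" using eq by (auto simp: edges_def)
  qed (use eq in auto)
qed

lemma edges_iff_pair_color:
  assumes "edge_colored G"
  shows "{u, v} \<in> edges G \<longleftrightarrow> pair_color G u v \<noteq> 0"
proof
  assume "{u, v} \<in> edges G"
  then obtain i where "{u, v} \<in> cedges G i" by (auto simp: edges_def)
  then show "pair_color G u v \<noteq> 0" by (simp add: cedges_iff_pair_color[OF assms])
qed (simp add: pair_color_def split: if_splits)

lemma pair_color_commute: "pair_color G u v = pair_color G v u"
  by (simp add: pair_color_def insert_commute)

section \<open>The binary counter\<close>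

fun inc_bits :: "bool list \<Rightarrow> bool \<times> bool list" where
  "inc_bits [] = (True, [])"
| "inc_bits (b # bs) = (b \<and> fst (inc_bits bs), (b \<noteq> fst (inc_bits bs)) # snd (inc_bits bs))"

fun bits_val :: "bool list \<Rightarrow> nat" where
  "bits_val [] = 0"
| "bits_val (b # bs) = (if b then 2 ^ length bs else 0) + bits_val bs"

lemma length_inc_bits [simp]: "length (snd (inc_bits bs)) = length bs"
  by (induction bs) auto

lemma bits_val_less: "bits_val bs < 2 ^ length bs"
  by (induction bs) auto

lemma bits_val_inc_bits: "bits_val (snd (inc_bits bs)) + (if fst (inc_bits bs) then 2 ^ length bs else 0) = bits_val bs + 1"
  by (induction bs) (auto split: if_splits)

lemma fst_inc_bits_iff: "fst (inc_bits bs) \<longleftrightarrow> bits_val bs + 1 = 2 ^ length bs"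
  using bits_val_inc_bits[of bs] bits_val_less[of "snd (inc_bits bs)"] bits_val_less[of bs] by (auto split: if_splits)

text \<open>Counting through all values therefore meets each bit list exactly once.\<close>

lemma bits_val_inj: "length bs = length bs' \<Longrightarrow> bits_val bs = bits_val bs' \<Longrightarrow> bs = bs'"
proof (induction bs bs' rule: list_induct2)
  case (Cons b bs b' bs')
  then show ?case using bits_val_less[of bs] bits_val_less[of bs'] by (auto split: if_splits)
qed simp

lemma bits_val_replicate_False: "bits_val (replicate n False) = 0"
  by (induction n) auto

definition enc_bits :: "tree list \<Rightarrow> bool list \<Rightarrow> tree" where
  "enc_bits qs bs = enc_list (map2 (\<lambda>b q. CONS (bool_tree b) q) bs qs)"

lemma increment_enc_bits:
  assumes "length bs = length qs"
  shows "increment (enc_bits qs bs) = CONS (bool_tree (fst (inc_bits bs))) (enc_bits qs (snd (inc_bits bs)))"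
  unfolding increment_def using assms
  by (induction bs qs rule: list_induct2)
    (simp_all add: enc_bits_def conj_commute)

text \<open>Color \<open>Suc c\<close> is declared only if some edge receives it, because a legal
  graph has no empty color class.\<close>

definition reduce :: "nat \<Rightarrow> 'v ecgraph \<Rightarrow> 'v set set \<Rightarrow> 'v ecgraph" where
  "reduce c G S = \<lparr>verts = verts G,
     ncolors = (if \<exists>j>c. cedges G j - S \<noteq> {} then Suc c else c),
     cedges = (\<lambda>i. if i \<le> c then cedges G i - S
       else if i = Suc c then (\<Union>j\<in>{c<..}. cedges G j) - S else {})\<rparr>"

lemma edge_colored_reduce:
  assumes G: "edge_colored G" and ne: "\<And>i. i \<in> {1..c} \<Longrightarrow> cedges G i - S \<noteq> {}"
  shows "edge_colored (reduce c G S)"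
proof -
  let ?H = "reduce c G S"
  have 0: "cedges G 0 = {}" using edge_coloredD(1)[OF G] by (auto simp: colors_def)
  have "cedges ?H i \<noteq> {}" if "i \<in> colors ?H" for i
    using that ne[of i] by (auto simp: colors_def reduce_def split: if_splits)
  moreover have "e \<subseteq> verts ?H \<and> card e = 2" if e: "e \<in> cedges ?H i" for e i
  proof -
    obtain j where "e \<in> cedges G j" using e by (auto simp: reduce_def split: if_splits)
    then show ?thesis using edge_coloredD(2,3)[OF G] by (auto simp: reduce_def)
  qed
  moreover have "cedges ?H i \<inter> cedges ?H j = {}" if "i \<noteq> j" for i j
  proof (rule ccontr)
    assume "cedges ?H i \<inter> cedges ?H j \<noteq> {}"
    then obtain e where "e \<in> cedges ?H i" "e \<in> cedges ?H j" by blast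
    \<comment> \<open>Merging replaces a color \<open>i'\<close> by the minimum of \<open>i'\<close>
      and \<open>Suc c\<close>, so an edge with a unique old color has a unique new one.\<close>
    then obtain i' j' where "e \<in> cedges G i'" "i = min i' (Suc c)" "e \<in> cedges G j'" "j = min j' (Suc c)"
      by (fastforce simp: reduce_def split: if_splits)
    then show False using that cedges_unique[OF G] by metis
  qed
  moreover have "cedges ?H i = {}" if "i \<notin> colors ?H" for i
    using that 0 by (cases "i = 0") (auto simp: colors_def reduce_def split: if_splits)
  moreover have "finite (verts ?H)" using G by (simp add: edge_colored_def reduce_def)
  ultimately show ?thesis unfolding edge_colored_def by (intro conjI ballI allI impI) auto
qed

lemma pair_color_reduce:
  assumes G: "edge_colored G" and H: "edge_colored (reduce c G S)"
  shows "pair_color (reduce c G S) u v = (if {u, v} \<in> S then 0 else min (pair_color G u v) (Suc c))"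
    (is "_ = ?m")
proof (cases "?m = 0")
  case True
  then have "{u, v} \<notin> cedges (reduce c G S) i" for i
    by (auto simp: reduce_def cedges_iff_pair_color[OF G] min_def split: if_splits)
  then have "pair_color (reduce c G S) u v = 0"
    using cedges_iff_pair_color[OF H, of u v "pair_color (reduce c G S) u v"] by simp
  then show ?thesis using True by simp
next
  case False
  then have "{u, v} \<in> cedges (reduce c G S) ?m"
    by (auto simp: reduce_def cedges_iff_pair_color[OF G] min_def split: if_splits)
  then show ?thesis using cedges_iff_pair_color[OF H, of u v ?m] by simp
qed

text \<open>The two containments hold for the same embeddings: the image of a pair must avoid all
  colors above \<open>c\<close>, and it does so before merging exactly if it does so
  afterwards.\<close>

lemma contains_induced_reduce:
  assumes F: "c_colored c F"
  shows "contains_induced (reduce c G S) F \<longleftrightarrow> contains_induced (delete_edges G S) F"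
proof -
  have F0: "e \<notin> cedges F i" if "i > c" for e i
    using that F edge_coloredD(1)[of F e i] by (auto simp: c_colored_def colors_def)
  have "(\<forall>i. e \<in> cedges F i \<longleftrightarrow> e' \<in> cedges (reduce c G S) i) \<longleftrightarrow>
      (\<forall>i. e \<in> cedges F i \<longleftrightarrow> e' \<in> cedges (delete_edges G S) i)" (is "?l \<longleftrightarrow> ?r") for e e'
  proof
    assume l: ?l
    have "e' \<notin> cedges (reduce c G S) (Suc c)" using l F0[of "Suc c"] by blast
    then have "e' \<notin> cedges (delete_edges G S) i" if "i > c" for i
      using that by (auto simp: reduce_def delete_edges_def)
    moreover have "e \<in> cedges F i \<longleftrightarrow> e' \<in> cedges (delete_edges G S) i" if "i \<le> c" for i
      using l[rule_format, of i] that by (simp add: reduce_def delete_edges_def)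
    ultimately show ?r using F0 by (metis not_le)
  next
    assume r: ?r
    have "e' \<notin> cedges (delete_edges G S) i" if "i > c" for i using r F0[OF that] by blast
    then have "e' \<notin> cedges (reduce c G S) i" if "i > c" for i
      using that by (auto simp: reduce_def delete_edges_def)
    moreover have "e \<in> cedges F i \<longleftrightarrow> e' \<in> cedges (reduce c G S) i" if "i \<le> c" for i
      using r[rule_format, of i] that by (simp add: reduce_def delete_edges_def)
    ultimately show ?l using F0 by (metis not_le)
  qed
  moreover have "verts (reduce c G S) = verts (delete_edges G S)"
    by (simp add: reduce_def delete_edges_def)
  ultimately show ?thesis unfolding contains_induced_iff_embedding by simp
qed

lemma contains_induced_all_colors:
  assumes F: "c_colored c F" and "contains_induced G F" "i \<in> {1..c}"
  shows "cedges G i \<noteq> {}"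
proof -
  have ec: "edge_colored F" "i \<in> colors F" using assms by (auto simp: c_colored_def colors_def)
  then obtain e where e: "e \<in> cedges F i" unfolding edge_colored_def by blast
  obtain x y where xy: "e = {x, y}" "x \<in> verts F" "y \<in> verts F"
    using edges_cases[OF ec(1) edge_coloredD(4)[OF ec(1) e]] by metis
  obtain g where "\<forall>x\<in>verts F. \<forall>y\<in>verts F. \<forall>i. {x, y} \<in> cedges F i \<longleftrightarrow> {g x, g y} \<in> cedges G i"
    using assms(2) unfolding contains_induced_iff_embedding by blast
  then show ?thesis using e xy by blast
qed

section \<open>Meaning of the tree operations on an input graph\<close>

locale input_graph =
  fixes G :: "nat ecgraph"
  assumes input: "G \<in> input_graphs"
begin

abbreviation n :: nat where "n \<equiv> card (verts G)"

abbreviation R :: "(nat \<times> nat) set" where "R \<equiv> nbh_rel G"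

lemma G: "edge_colored G" and verts_eq: "verts G = {..<n}"
  using input by (auto simp: input_graphs_def)

lemma equiv_R: "equiv {..<n} R"
  using equiv_nbh_rel[OF G] verts_eq by simp

lemma R_iff_pair_color:
  "(u, v) \<in> R \<longleftrightarrow> u < n \<and> v < n \<and>
     (\<forall>w<n. w = u \<or> w = v \<or> pair_color G u w = pair_color G v w)"
proof -
  have "(\<forall>i. {w, u} \<in> cedges G i \<longleftrightarrow> {w, v} \<in> cedges G i) \<longleftrightarrow> pair_color G u w = pair_color G v w" for w
    unfolding cedges_iff_pair_color[OF G] pair_color_commute[of G w] by metis
  moreover have "{w, x} \<notin> cedges G i" if "\<not> w < n" for w x i
    using edge_coloredD(2)[OF G, of "{w, x}" i] that verts_eq by auto
  moreover have "u \<in> verts G \<longleftrightarrow> u < n" for u using verts_eq by auto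
  ultimately show ?thesis unfolding nbh_rel_iff[OF G] by metis
qed

lemma lst_vertex_list: "lst (vertex_list (enc_graph G)) = map enc_nat [0..<n]"
  by (simp add: vertex_list_def foldr_vertex_list enc_graph_def Let_def)

lemma entry_enc_graph:
  assumes "u < n" "v < n"
  shows "entry (enc_graph G) (enc_nat u) (enc_nat v) = enc_nat (pair_color G u v)"
  using assms by (simp add: entry_def enc_graph_def Let_def head_drop_tree_enc_list)

lemma twin_enc: "u < n \<Longrightarrow> v < n \<Longrightarrow> twin (enc_graph G) (enc_nat u) (enc_nat v) \<longleftrightarrow> (u, v) \<in> R"
  by (auto simp: twin_def lst_vertex_list entry_enc_graph R_iff_pair_color)

definition rep_list :: "nat list" where
  "rep_list = filter (\<lambda>u. \<forall>w<u. (w, u) \<notin> R) [0..<n]"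

lemma lst_reps: "lst (reps (enc_graph G)) = map enc_nat rep_list"
  unfolding reps_def rep_list_def lst_vertex_list lst_enc_list filter_map
proof (intro arg_cong[of _ _ "map enc_nat"] filter_cong refl)
  fix u assume u: "u \<in> set [0..<n]"
  have "(\<exists>w\<in>set [0..<n]. w < u \<and> twin (enc_graph G) (enc_nat w) (enc_nat u)) \<longleftrightarrow>
      (\<exists>w<u. (w, u) \<in> R)"
    using u by (force simp: twin_enc)
  then show "((\<lambda>u. \<not> (\<exists>w\<in>set (map enc_nat [0..<n]). drop_tree u w \<noteq> NIL \<and> twin (enc_graph G) w u))
      \<circ> enc_nat) u \<longleftrightarrow> (\<forall>w<u. (w, u) \<notin> R)"
    by auto
qed

lemma rep_list_less: "r \<in> set rep_list \<Longrightarrow> r < n"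
  by (auto simp: rep_list_def)

lemma ex_rep_list:
  assumes "u < n"
  obtains r where "r \<in> set rep_list" "(u, r) \<in> R"
proof -
  define r where "r = (LEAST w. (w, u) \<in> R)"
  have uu: "(u, u) \<in> R" using assms equiv_R by (auto simp: equiv_def refl_on_def)
  have ru: "(r, u) \<in> R" unfolding r_def using uu by (rule LeastI)
  have ur: "(u, r) \<in> R" using ru equiv_R by (auto simp: equiv_def sym_def)
  have "(w, r) \<notin> R" if "w < r" for w
  proof
    assume "(w, r) \<in> R"
    then have "(w, u) \<in> R" using ru equiv_R by (meson equiv_def transD)
    then have "r \<le> w" unfolding r_def by (rule Least_le)
    then show False using that by simp
  qed
  moreover have "r < n" using ru by (simp add: R_iff_pair_color)
  ultimately have "r \<in> set rep_list" by (simp add: rep_list_def)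
  then show thesis using ur that by blast
qed

text \<open>Sending a representative to its class is a bijection, since \<open>rep_list\<close>
  collects the least vertex of each class.\<close>

lemma length_rep_list: "length rep_list = nbh_diversity G"
proof -
  have "bij_betw (\<lambda>r. R `` {r}) (set rep_list) (nbh_classes G)"
    unfolding bij_betw_def
  proof
    show "inj_on (\<lambda>r. R `` {r}) (set rep_list)"
    proof (rule inj_onI)
      fix r r' assume r: "r \<in> set rep_list" "r' \<in> set rep_list" and "R `` {r} = R `` {r'}"
      then have "(r, r') \<in> R" "(r', r) \<in> R"
        using eq_equiv_class[OF _ equiv_R] rep_list_less by (metis lessThan_iff)+
      then show "r = r'" using r by (auto simp: rep_list_def intro: linorder_neqE_nat)
    qed
    show "(\<lambda>r. R `` {r}) ` set rep_list = nbh_classes G"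
    proof
      show "(\<lambda>r. R `` {r}) ` set rep_list \<subseteq> nbh_classes G"
        using rep_list_less verts_eq by (auto simp: nbh_classes_def intro!: quotientI)
      show "nbh_classes G \<subseteq> (\<lambda>r. R `` {r}) ` set rep_list"
      proof
        fix C assume "C \<in> nbh_classes G"
        then obtain u where u: "u < n" "C = R `` {u}"
          using verts_eq by (auto simp: nbh_classes_def elim!: quotientE)
        obtain r where r: "r \<in> set rep_list" "(u, r) \<in> R" by (rule ex_rep_list[OF u(1)])
        then have "C = R `` {r}" using u equiv_class_eq[OF equiv_R] by blast
        then show "C \<in> (\<lambda>r. R `` {r}) ` set rep_list" using r by blast
      qed
    qed
  qed
  then have "card (set rep_list) = nbh_diversity G"
    by (simp add: nbh_diversity_def bij_betw_same_card)
  moreover have "distinct rep_list" by (simp add: rep_list_def)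
  ultimately show ?thesis by (simp add: distinct_card)
qed

definition rep_pairs :: "tree list" where
  "rep_pairs = lst (pairs (reps (enc_graph G)))"

lemma rep_pairs_eq: "rep_pairs = map (\<lambda>(r, r'). CONS (enc_nat r) (enc_nat r')) (List.product rep_list rep_list)"
  by (simp add: rep_pairs_def lst_pairs lst_reps product_map_map case_prod_unfold)

lemma length_rep_pairs: "length rep_pairs = (nbh_diversity G)\<^sup>2"
  by (simp add: rep_pairs_eq length_rep_list power2_eq_square)

definition del_pair :: "bool list \<Rightarrow> nat \<Rightarrow> nat \<Rightarrow> bool" where
  "del_pair bs u v \<longleftrightarrow> (\<exists>(b, r, r') \<in> set (zip bs (List.product rep_list rep_list)). b \<and>
     ((u, r) \<in> R \<and> (v, r') \<in> R \<or> (u, r') \<in> R \<and> (v, r) \<in> R))"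

definition del_set :: "bool list \<Rightarrow> nat set set" where
  "del_set bs = {e \<in> edges G. \<exists>u v. e = {u, v} \<and> del_pair bs u v}"

lemma del_pair_commute: "del_pair bs u v \<longleftrightarrow> del_pair bs v u"
  unfolding del_pair_def by blast

lemma del_set_iff: "{u, v} \<in> del_set bs \<longleftrightarrow> {u, v} \<in> edges G \<and> del_pair bs u v"
  unfolding del_set_def using del_pair_commute by (auto simp: doubleton_eq_iff)

lemma deleted_enc:
  assumes "u < n" "v < n"
  shows "deleted (enc_graph G) (enc_bits rep_pairs bs) (enc_nat u) (enc_nat v) \<longleftrightarrow> del_pair bs u v"
proof -
  let ?q = "\<lambda>(b, r, r'). CONS (bool_tree b) (CONS (enc_nat r) (enc_nat r'))"
  have eq: "set (lst (enc_bits rep_pairs bs)) = ?q ` set (zip bs (List.product rep_list rep_list))"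
    unfolding enc_bits_def lst_enc_list rep_pairs_eq zip_map2 by force
  have less: "r < n \<and> r' < n" if "(b, r, r') \<in> set (zip bs (List.product rep_list rep_list))" for b r r'
    using set_zip_rightD[OF that] rep_list_less by auto
  show ?thesis
    unfolding deleted_def eq del_pair_def bex_simps(7)
  proof (rule bex_cong[OF refl])
    fix z assume z: "z \<in> set (zip bs (List.product rep_list rep_list))"
    obtain b r r' where "z = (b, r, r')" by (cases z)
    with less z assms show "(head (?q z) \<noteq> NIL \<and>
        (twin (enc_graph G) (enc_nat u) (head (tail (?q z))) \<and> twin (enc_graph G) (enc_nat v) (tail (tail (?q z))) \<or>
         twin (enc_graph G) (enc_nat u) (tail (tail (?q z))) \<and> twin (enc_graph G) (enc_nat v) (head (tail (?q z))))) =
      (case z of (b, r, r') \<Rightarrow> b \<and> ((u, r) \<in> R \<and> (v, r') \<in> R \<or> (u, r') \<in> R \<and> (v, r) \<in> R))"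
      by (simp add: twin_enc)
  qed
qed

text \<open>The condition \<open>u < v\<close> selects one of the two orientations of every deleted
  edge, so listed pairs and deleted edges correspond one to one.\<close>

lemma length_cost: "length (lst (cost (enc_graph G) (enc_bits rep_pairs bs))) = card (del_set bs)"
proof -
  let ?P = "\<lambda>(u, v). u < v \<and> pair_color G u v \<noteq> 0 \<and> del_pair bs u v"
  let ?xs = "List.product [0..<n] [0..<n]"
  have "lst (pairs (vertex_list (enc_graph G))) = map (\<lambda>(u, v). CONS (enc_nat u) (enc_nat v)) ?xs"
    by (simp add: lst_pairs lst_vertex_list product_map_map case_prod_unfold)
  then have "length (lst (cost (enc_graph G) (enc_bits rep_pairs bs))) = length (filter ?P ?xs)"
    unfolding cost_def lst_enc_list
    by (simp add: filter_map, intro arg_cong[of _ _ length] filter_cong)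
      (auto simp: deleted_enc entry_enc_graph)
  also have "\<dots> = card (set (filter ?P ?xs))"
    by (rule distinct_card[symmetric]) (simp add: distinct_product)
  also have "\<dots> = card ((\<lambda>(u, v). {u, v}) ` set (filter ?P ?xs))"
    by (intro card_image[symmetric]) (auto simp: inj_on_def doubleton_eq_iff)
  also have "(\<lambda>(u, v). {u, v}) ` set (filter ?P ?xs) = del_set bs"
  proof
    show "(\<lambda>(u, v). {u, v}) ` set (filter ?P ?xs) \<subseteq> del_set bs"
      by (auto simp: del_set_iff edges_iff_pair_color[OF G])
    show "del_set bs \<subseteq> (\<lambda>(u, v). {u, v}) ` set (filter ?P ?xs)"
    proof
      fix e assume e: "e \<in> del_set bs"
      then have "e \<in> edges G" by (simp add: del_set_def)
      from edges_cases[OF G this] obtain u v where "e = {u, v}" "u \<noteq> v" "u < n" "v < n"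
        using verts_eq by (metis lessThan_iff)
      then obtain u v where uv: "e = {u, v}" "u < v" "u < n" "v < n"
        by (metis insert_commute linorder_neqE_nat)
      then show "e \<in> (\<lambda>(u, v). {u, v}) ` set (filter ?P ?xs)"
        using e by (intro image_eqI[of _ _ "(u, v)"]) (auto simp: del_set_iff edges_iff_pair_color[OF G])
    qed
  qed
  finally show ?thesis .
qed

lemma reduced_matrix_eq:
  "reduced_matrix c (enc_graph G) (enc_bits rep_pairs bs) = enc_list (map (\<lambda>u. enc_list (map (\<lambda>v.
     enc_nat (if {u, v} \<in> del_set bs then 0 else min (pair_color G u v) (Suc c))) [0..<n])) [0..<n])"
proof -
  have "(if deleted (enc_graph G) (enc_bits rep_pairs bs) (enc_nat u) (enc_nat v) then NIL
     else if drop_tree (entry (enc_graph G) (enc_nat u) (enc_nat v)) (enc_nat c) = NIL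
     then entry (enc_graph G) (enc_nat u) (enc_nat v) else enc_nat (Suc c)) =
    enc_nat (if {u, v} \<in> del_set bs then 0 else min (pair_color G u v) (Suc c))"
    if "u < n" "v < n" for u v
    using that by (auto simp: deleted_enc entry_enc_graph del_set_iff edges_iff_pair_color[OF G] min_def le_Suc_eq)
  then show ?thesis
    unfolding reduced_matrix_def lst_vertex_list map_map o_def by (intro arg_cong[of _ _ enc_list] map_cong) auto
qed

lemma present_reduced_matrix:
  "present c (reduced_matrix c (enc_graph G) (enc_bits rep_pairs bs)) \<longleftrightarrow> (\<forall>i\<in>{1..c}. cedges G i - del_set bs \<noteq> {})"
proof -
  have "(\<exists>u<n. \<exists>v<n. (if {u, v} \<in> del_set bs then 0 else min (pair_color G u v) (Suc c)) = i) \<longleftrightarrow>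
      cedges G i - del_set bs \<noteq> {}" (is "?l \<longleftrightarrow> ?r") if i: "i \<in> {1..c}" for i
  proof
    assume ?l
    then obtain u v where "{u, v} \<notin> del_set bs" "pair_color G u v = i"
      using i by (auto split: if_splits simp: min_def)
    then have "{u, v} \<in> cedges G i - del_set bs" using cedges_iff_pair_color[OF G, of u v i] i by simp
    then show ?r by blast
  next
    assume ?r
    then obtain e where e: "e \<in> cedges G i" "e \<notin> del_set bs" by blast
    from edges_cases[OF G edge_coloredD(4)[OF G e(1)]] obtain u v where
      uv: "e = {u, v}" "u < n" "v < n" using verts_eq by (metis lessThan_iff)
    then have "pair_color G u v = i" using cedges_iff_pair_color[OF G, of u v i] e by simp
    then show ?l using uv e i by (intro exI[of _ u] conjI exI[of _ v]) auto
  qed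
  moreover have "present c (reduced_matrix c (enc_graph G) (enc_bits rep_pairs bs)) \<longleftrightarrow>
      (\<forall>i\<in>{1..c}. \<exists>u<n. \<exists>v<n. (if {u, v} \<in> del_set bs then 0 else min (pair_color G u v) (Suc c)) = i)"
    unfolding present_def reduced_matrix_eq lst_enc_list set_map set_upt bex_simps ball_simps eq_nat_tree_enc_nat
    by (simp add: Ball_def Bex_def less_Suc_eq_le del: One_nat_def)
  ultimately show ?thesis by simp
qed

lemma reduced_matrix_reduce:
  assumes "present c (reduced_matrix c (enc_graph G) (enc_bits rep_pairs bs))"
  shows "reduced_matrix c (enc_graph G) (enc_bits rep_pairs bs) = enc_graph (reduce c G (del_set bs))"
    and "reduce c G (del_set bs) \<in> input_graphs"
proof -
  have H: "edge_colored (reduce c G (del_set bs))"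
    using assms by (intro edge_colored_reduce[OF G]) (auto simp: present_reduced_matrix)
  have v: "verts (reduce c G (del_set bs)) = verts G" by (simp add: reduce_def)
  show "reduced_matrix c (enc_graph G) (enc_bits rep_pairs bs) = enc_graph (reduce c G (del_set bs))"
    unfolding reduced_matrix_eq enc_graph_def[of "reduce c G (del_set bs)"] Let_def v pair_color_reduce[OF G H] ..
  show "reduce c G (del_set bs) \<in> input_graphs"
    using H v verts_eq by (simp add: input_graphs_def)
qed

text \<open>If all colors up to \<open>c\<close> remain, the decider is right about the reduced
  graph; if one is missing, no member of \<open>\<F>\<close> fits and no query is necessary.\<close>

lemma free_after_iff_decider:
  assumes \<F>: "\<forall>F\<in>\<F>. c_colored c F"
    and dec: "\<And>H. H \<in> input_graphs \<Longrightarrow> dec (enc_graph H) \<noteq> NIL \<longleftrightarrow> (\<exists>F\<in>\<F>. contains_induced H F)"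
  shows "free_after \<F> G (del_set bs) \<longleftrightarrow>
    \<not> present c (reduced_matrix c (enc_graph G) (enc_bits rep_pairs bs)) \<or> dec (reduced_matrix c (enc_graph G) (enc_bits rep_pairs bs)) = NIL"
proof (cases "present c (reduced_matrix c (enc_graph G) (enc_bits rep_pairs bs))")
  case True
  have "dec (reduced_matrix c (enc_graph G) (enc_bits rep_pairs bs)) \<noteq> NIL \<longleftrightarrow>
      (\<exists>F\<in>\<F>. contains_induced (reduce c G (del_set bs)) F)"
    using dec[OF reduced_matrix_reduce(2)[OF True]] reduced_matrix_reduce(1)[OF True] by simp
  also have "\<dots> \<longleftrightarrow> \<not> free_after \<F> G (del_set bs)"
    using \<F> by (simp add: free_after_def contains_induced_reduce cong: bex_cong)
  finally show ?thesis using True by simp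
next
  case False
  then obtain i where "i \<in> {1..c}" "cedges (delete_edges G (del_set bs)) i = {}"
    by (auto simp: present_reduced_matrix delete_edges_def)
  then have "\<not> contains_induced (delete_edges G (del_set bs)) F" if "F \<in> \<F>" for F
    using contains_induced_all_colors \<F> that by blast
  then show ?thesis using False by (simp add: free_after_def)
qed

text \<open>Completeness of the enumeration: the bit of a pair of representatives records whether
  that pair itself belongs to \<open>S\<close>, and uniformity spreads this to all pairs between the
  two classes.\<close>

lemma ex_del_set:
  assumes S: "S \<subseteq> edges G" and unif: "\<And>C. C \<in> nbh_classes G \<Longrightarrow> uniform_on S C"
  obtains bs where "length bs = length rep_pairs" "del_set bs = S"
proof
  let ?bs = "map (\<lambda>(r, r'). {r, r'} \<in> S) (List.product rep_list rep_list)"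
  show "length ?bs = length rep_pairs" by (simp add: rep_pairs_eq)
  \<comment> \<open>Uniformity on the class of \<open>r\<close> permits replacing one endpoint of a
    pair by its representative; this is applied to both endpoints in turn.\<close>
  have move: "{v, u} \<in> S \<longleftrightarrow> {v, r} \<in> S" if "(u, r) \<in> R" for u v r
  proof -
    have "r < n" "(r, u) \<in> R" using that equiv_R by (auto simp: R_iff_pair_color equiv_def sym_def)
    moreover have "(r, r) \<in> R" using \<open>r < n\<close> equiv_R by (auto simp: equiv_def refl_on_def)
    moreover have "uniform_on S (R `` {r})"
      using \<open>r < n\<close> verts_eq by (intro unif) (auto simp: nbh_classes_def intro!: quotientI)
    ultimately show ?thesis unfolding uniform_on_def by blast
  qed
  have "set (zip ?bs (List.product rep_list rep_list)) = (\<lambda>(r, r'). ({r, r'} \<in> S, r, r')) ` (set rep_list \<times> set rep_list)"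
  proof -
    have "zip (map f xs) xs = map (\<lambda>x. (f x, x)) xs" for f :: "nat \<times> nat \<Rightarrow> bool" and xs
      by (induction xs) auto
    then show ?thesis by force
  qed
  then have del: "del_pair ?bs u v \<longleftrightarrow> (\<exists>r\<in>set rep_list. \<exists>r'\<in>set rep_list. {r, r'} \<in> S \<and>
     ((u, r) \<in> R \<and> (v, r') \<in> R \<or> (u, r') \<in> R \<and> (v, r) \<in> R))" for u v
    unfolding del_pair_def by simp
  have "{u, v} \<in> S \<longleftrightarrow> del_pair ?bs u v" if uv: "u < n" "v < n" for u v
  proof
    assume "{u, v} \<in> S"
    moreover obtain r where r: "r \<in> set rep_list" "(u, r) \<in> R" by (rule ex_rep_list[OF uv(1)])
    moreover obtain r' where r': "r' \<in> set rep_list" "(v, r') \<in> R" by (rule ex_rep_list[OF uv(2)])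
    moreover have "{u, v} \<in> S \<longleftrightarrow> {u, r'} \<in> S" by (rule move[OF r'(2)])
    moreover have "{r', u} \<in> S \<longleftrightarrow> {r', r} \<in> S" by (rule move[OF r(2)])
    ultimately show "del_pair ?bs u v" unfolding del by (metis insert_commute)
  next
    assume "del_pair ?bs u v"
    then obtain r r' where "{r, r'} \<in> S" "(u, r) \<in> R \<and> (v, r') \<in> R \<or> (u, r') \<in> R \<and> (v, r) \<in> R"
      unfolding del by blast
    then show "{u, v} \<in> S" using move[of u r] move[of v r'] move[of u r'] move[of v r]
      by (metis insert_commute)
  qed
  then have *: "{u, v} \<in> del_set ?bs \<longleftrightarrow> {u, v} \<in> S" if "u < n" "v < n" for u v
    using that S by (auto simp: del_set_iff)
  have "e \<in> del_set ?bs \<longleftrightarrow> e \<in> S" for e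
  proof (cases "e \<in> edges G")
    case True
    obtain u v where uv: "e = {u, v}" "u \<in> verts G" "v \<in> verts G"
      by (rule edges_cases[OF G True])
    then have "u < n" "v < n" using verts_eq by blast+
    then show ?thesis unfolding uv(1) by (rule *)
  next
    case False
    then show ?thesis using S by (auto simp: del_set_def)
  qed
  then show "del_set ?bs = S" by blast
qed

lemma card_edges_le: "card (edges G) \<le> n * n"
proof -
  have "edges G \<subseteq> (\<lambda>(u, v). {u, v}) ` ({..<n} \<times> {..<n})"
  proof
    fix e assume "e \<in> edges G"
    from edges_cases[OF G this] obtain u v where "e = {u, v}" "u < n" "v < n"
      using verts_eq by (metis lessThan_iff)
    then show "e \<in> (\<lambda>(u, v). {u, v}) ` ({..<n} \<times> {..<n})" by auto
  qed
  then have "card (edges G) \<le> card ({..<n} \<times> {..<n})"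
    by (intro surj_card_le) auto
  then show ?thesis by (simp add: card_cartesian_product)
qed

lemma card_del_set_le: "card (del_set bs) \<le> n * n"
proof -
  have "card (del_set bs) \<le> card (edges G)"
    by (intro card_mono finite_edges[OF G]) (auto simp: del_set_def)
  then show ?thesis using card_edges_le by simp
qed

text \<open>The budget may be cut off at \<open>n * n\<close>, as no set of edges is larger. A
  negative budget is never met because cardinalities are non-negative.\<close>

lemma deletion_yes_iff:
  assumes \<F>: "\<forall>F\<in>\<F>. c_colored c F" "\<forall>F\<in>\<F>. color_diverse F"
  shows "(G, k) \<in> deletion_yes \<F> \<longleftrightarrow> 0 \<le> k \<and>
    (\<exists>bs. length bs = length rep_pairs \<and> card (del_set bs) \<le> min (nat \<bar>k\<bar>) (n * n) \<and>
      free_after \<F> G (del_set bs))"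
proof
  assume "(G, k) \<in> deletion_yes \<F>"
  then obtain S where S: "S \<subseteq> edges G" "int (card S) \<le> k" "free_after \<F> G S"
    by (auto simp: deletion_yes_def free_after_def)
  obtain S' where S': "S' \<subseteq> edges G" "free_after \<F> G S'" "card S' \<le> card S"
    "\<And>C. C \<in> nbh_classes G \<Longrightarrow> uniform_on S' C"
    by (rule uniform_solution[OF G _ S(1,3)]) (use \<F> in \<open>auto simp: c_colored_def\<close>)
  obtain bs where bs: "length bs = length rep_pairs" "del_set bs = S'"
    by (rule ex_del_set[OF S'(1,4)])
  show "0 \<le> k \<and> (\<exists>bs. length bs = length rep_pairs \<and> card (del_set bs) \<le> min (nat \<bar>k\<bar>) (n * n) \<and>
      free_after \<F> G (del_set bs))"
    using S S' bs card_del_set_le[of bs] by (intro conjI exI[of _ bs]) auto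
next
  assume "0 \<le> k \<and> (\<exists>bs. length bs = length rep_pairs \<and> card (del_set bs) \<le> min (nat \<bar>k\<bar>) (n * n) \<and>
      free_after \<F> G (del_set bs))"
  then obtain bs where "0 \<le> k" "card (del_set bs) \<le> nat k" "free_after \<F> G (del_set bs)"
    by auto
  then show "(G, k) \<in> deletion_yes \<F>"
    unfolding deletion_yes_def free_after_def
    by (auto intro!: exI[of _ "del_set bs"] simp: del_set_def)
qed

section \<open>Sizes in terms of the number of vertices\<close>

text \<open>Choosing one edge from each color class is injective by disjointness, so there are at
  most as many colors as edges. This bounds the unary entries and turns bounds in the size of the
  encoding into bounds in \<open>n\<close>.\<close>

lemma pair_color_le: "pair_color G u v \<le> n * n"
proof (cases "pair_color G u v = 0")
  case False
  then have "{u, v} \<in> cedges G (pair_color G u v)" using cedges_iff_pair_color[OF G] by simp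
  from edge_coloredD(1)[OF G this] have "pair_color G u v \<le> ncolors G" by (simp add: colors_def)
  also have "ncolors G \<le> card (edges G)"
  proof -
    define f where "f i = (SOME e. e \<in> cedges G i)" for i
    have f: "f i \<in> cedges G i" if "i \<in> colors G" for i
      using that G unfolding f_def edge_colored_def by (metis some_in_eq)
    have "inj_on f (colors G)"
    proof (rule inj_onI)
      fix i j assume ij: "i \<in> colors G" "j \<in> colors G" "f i = f j"
      show "i = j" by (rule cedges_unique[OF G f[OF ij(1)]]) (use f[OF ij(2)] ij(3) in simp)
    qed
    moreover have "f ` colors G \<subseteq> edges G" using f by (auto simp: edges_def)
    ultimately have "card (colors G) \<le> card (edges G)" using finite_edges[OF G] by (rule card_inj_on_le)
    then show ?thesis by (simp add: colors_def)
  qed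
  finally show ?thesis using card_edges_le by simp
qed simp

lemma tree_size_enc_graph: "tree_size (enc_graph G) \<le> 1 + n * (n * (2 * (n * n) + 2) + 2)"
proof -
  have row: "tree_size (enc_list (map (\<lambda>v. enc_nat (pair_color G u v)) [0..<n])) \<le> 1 + n * (2 * (n * n) + 2)" for u
  proof -
    have "(\<Sum>v\<leftarrow>[0..<n]. tree_size (enc_nat (pair_color G u v)) + 1) \<le> (\<Sum>v\<leftarrow>[0..<n]. 2 * (n * n) + 2)"
      using pair_color_le[of u] by (intro sum_list_mono) (simp add: tree_size_enc_nat)
    then show ?thesis by (simp add: tree_size_enc_list o_def sum_list_triv)
  qed
  have "(\<Sum>u\<leftarrow>[0..<n]. tree_size (enc_list (map (\<lambda>v. enc_nat (pair_color G u v)) [0..<n])) + 1)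
      \<le> (\<Sum>u\<leftarrow>[0..<n]. n * (2 * (n * n) + 2) + 2)"
    using row by (intro sum_list_mono) (simp add: add.commute)
  then show ?thesis
    unfolding enc_graph_def Let_def tree_size_enc_list map_map o_def by (simp add: sum_list_triv)
qed

section \<open>The enumeration loop\<close>

definition state :: "bool \<Rightarrow> bool \<Rightarrow> bool list \<Rightarrow> tree \<Rightarrow> nat \<Rightarrow> tree" where
  "state b fl bs sg m = CONS (bool_tree b) (CONS (bool_tree fl) (CONS (enc_bits rep_pairs bs)
     (CONS sg (CONS (enc_graph G) (enc_nat m)))))"

lemma first_state_eq:
  "first_state (CONS sg (CONS (enc_graph G) (enc_nat m))) =
     state True False (replicate (length rep_pairs) False) sg m"
proof -
  have "map (CONS NIL) xs = map2 (\<lambda>b q. CONS (bool_tree b) q) (replicate (length xs) False) xs" for xs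
    by (induction xs) (auto simp: bool_tree_def)
  then show ?thesis by (simp add: first_state_def state_def enc_bits_def rep_pairs_def)
qed

text \<open>Only truth values change between states, and their sizes lie between 1 and 3. Hence one
  bound serves all the exponentially many rounds; the constant 13 is generous.\<close>

lemma tree_size_state:
  assumes "length bs = length rep_pairs"
  shows "tree_size (state b fl bs sg m) \<le>
    13 * tree_size (first_state (CONS sg (CONS (enc_graph G) (enc_nat m))))"
proof -
  have "tree_size (enc_bits xs bs) \<le> 3 * tree_size (enc_bits xs (replicate (length xs) False))"
    if "length bs = length xs" for xs
    using that
  proof (induction bs xs rule: list_induct2)
    case (Cons b bs x xs)
    then show ?case using tree_size_bool_tree[of b] by (simp add: enc_bits_def bool_tree_def)
  qed (simp add: enc_bits_def)
  from this[OF assms] show ?thesis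
    using tree_size_bool_tree[of b] tree_size_bool_tree[of fl] by (simp add: first_state_eq state_def)
qed

text \<open>The decider is never called outside its domain: if a color is missing, the query is
  \<open>NIL\<close>, which encodes the graph without vertices.\<close>

lemma query_state:
  "query c (state b fl bs sg m) \<in> enc_graph ` input_graphs"
proof (cases "present c (reduced_matrix c (enc_graph G) (enc_bits rep_pairs bs))")
  case True
  then show ?thesis using reduced_matrix_reduce[OF True] by (auto simp: query_def state_def)
next
  case False
  let ?E = "\<lparr>verts = {}, ncolors = 0, cedges = \<lambda>i. {}\<rparr> :: nat ecgraph"
  have "?E \<in> input_graphs" by (simp add: input_graphs_def edge_colored_def colors_def)
  moreover have "enc_graph ?E = NIL" by (simp add: enc_graph_def)
  moreover have "query c (state b fl bs sg m) = NIL" using False by (simp add: query_def state_def)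
  ultimately show ?thesis by (metis image_eqI)
qed

lemma next_state_state:
  assumes \<F>: "\<forall>F\<in>\<F>. c_colored c F"
    and dec: "\<And>H. H \<in> input_graphs \<Longrightarrow> dec (enc_graph H) \<noteq> NIL \<longleftrightarrow> (\<exists>F\<in>\<F>. contains_induced H F)"
    and len: "length bs = length rep_pairs"
  shows "next_state c (dec (query c (state b fl bs sg m))) (state b fl bs sg m) =
    state (\<not> fst (inc_bits bs))
      (fl \<or> sg = NIL \<and> card (del_set bs) \<le> m \<and> free_after \<F> G (del_set bs))
      (snd (inc_bits bs)) sg m"
proof -
  have "drop_tree (cost (enc_graph G) (enc_bits rep_pairs bs)) (enc_nat m) = NIL \<longleftrightarrow> card (del_set bs) \<le> m"
    by (simp add: drop_tree_eq length_cost)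
  moreover have "free_after \<F> G (del_set bs) \<longleftrightarrow>
      \<not> present c (reduced_matrix c (enc_graph G) (enc_bits rep_pairs bs)) \<or> dec (query c (state b fl bs sg m)) = NIL"
    using free_after_iff_decider[OF \<F> dec, of bs] by (auto simp: query_def state_def)
  ultimately have "accept c (dec (query c (state b fl bs sg m))) (state b fl bs sg m) \<longleftrightarrow>
      sg = NIL \<and> card (del_set bs) \<le> m \<and> free_after \<F> G (del_set bs)"
    by (simp add: accept_def state_def)
  then show ?thesis
    using increment_enc_bits[OF len] by (simp add: next_state_def state_def)
qed

text \<open>The exponential factor arises here alone, as the number of rounds. It multiplies a cost
  that is the same for all rounds, because the state does not grow beyond a constant factor.\<close>

lemma runs_enumeration:
  assumes \<F>: "\<forall>F\<in>\<F>. c_colored c F"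
    and dec: "\<And>H. H \<in> input_graphs \<Longrightarrow> dec (enc_graph H) \<noteq> NIL \<longleftrightarrow> (\<exists>F\<in>\<F>. contains_induced H F)"
    and B: "poly_bounded B"
    and p: "subroutine p N {x. query c x \<in> enc_graph ` input_graphs}
      (\<lambda>x. next_state c (dec (query c x)) x) B"
    and s: "s 0 = first_state (CONS sg (CONS (enc_graph G) (enc_nat m)))"
  shows "runs (While (Hd_e (Var 0)) p) s
    ((2 ^ (nbh_diversity G)\<^sup>2 + 1) * (3 + B (13 * tree_size (s 0))))
    (\<lambda>s'. head (tail (s' 0)) = bool_tree (sg = NIL \<and> (\<exists>bs. length bs = length rep_pairs \<and>
        card (del_set bs) \<le> m \<and> free_after \<F> G (del_set bs))))"
proof -
  let ?L = "2 ^ length rep_pairs :: nat"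
  define ok where "ok bs \<longleftrightarrow> sg = NIL \<and> card (del_set bs) \<le> m \<and> free_after \<F> G (del_set bs)" for bs
  define found where "found i \<longleftrightarrow> (\<exists>bs. length bs = length rep_pairs \<and> bits_val bs < i \<and> ok bs)" for i
  \<comment> \<open>After the last round the counter has wrapped around and its value no longer
    equals the index, so the invariant fixes the value only for \<open>i < ?L\<close>.\<close>
  define I where "I i s' \<longleftrightarrow> (\<exists>bs. length bs = length rep_pairs \<and> (i < ?L \<longrightarrow> bits_val bs = i) \<and>
    s' 0 = state (i < ?L) (found i) bs sg m)" for i and s' :: store
  have "runs (While (Hd_e (Var 0)) p) s
      ((?L + 1) * (1 + expr_time (Hd_e (Var 0)) + B (13 * tree_size (s 0)))) (I ?L)"
  proof (rule runs_While)
    show "I 0 s" unfolding I_def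
      by (rule exI[of _ "replicate (length rep_pairs) False"])
        (simp add: s first_state_eq bits_val_replicate_False found_def)
    show "expr_val (Hd_e (Var 0)) s' = NIL" if "I ?L s'" for s'
      using that by (auto simp: I_def state_def bool_tree_def)
    fix i s' assume i: "i < ?L" and "I i s'"
    then obtain bs where bs: "length bs = length rep_pairs" "bits_val bs = i"
      and s': "s' 0 = state True (found i) bs sg m" by (auto simp: I_def)
    have nz: "expr_val (Hd_e (Var 0)) s' \<noteq> NIL" using s' by (simp add: state_def)
    \<comment> \<open>By injectivity of \<open>bits_val\<close>, the list examined in round
      \<open>i\<close> is the only one of value \<open>i\<close>.\<close>
    have "found (Suc i) \<longleftrightarrow> found i \<or> ok bs"
      using bs bits_val_inj unfolding found_def less_Suc_eq by metis
    moreover have "Suc i < ?L \<longleftrightarrow> \<not> fst (inc_bits bs)"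
      using fst_inc_bits_iff[of bs] bs i by auto
    moreover have "bits_val (snd (inc_bits bs)) = Suc i" if "\<not> fst (inc_bits bs)"
      using bits_val_inc_bits[of bs] bs that by simp
    ultimately have I: "I (Suc i) r"
      if "r 0 = next_state c (dec (query c (state True (found i) bs sg m))) (state True (found i) bs sg m)" for r
      unfolding I_def using that bs next_state_state[OF \<F> dec bs(1)]
      by (intro exI[of _ "snd (inc_bits bs)"]) (simp add: ok_def)
    have "B (tree_size (s' 0)) \<le> B (13 * tree_size (s 0))"
      unfolding s' s by (rule poly_bounded_monoD[OF B tree_size_state[OF bs(1)]])
    moreover have "runs p s' (B (tree_size (s' 0))) (I (Suc i))"
      by (rule subroutine_runs[OF p refl]) (use query_state I s' in auto)
    ultimately have "runs p s' (B (13 * tree_size (s 0))) (I (Suc i))" by (rule runs_le[rotated])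
    with nz show "expr_val (Hd_e (Var 0)) s' \<noteq> NIL \<and> runs p s' (B (13 * tree_size (s 0))) (I (Suc i))"
      by blast
  qed
  then show ?thesis
  proof (rule runs_mono)
    show "head (tail (s' 0)) = bool_tree (sg = NIL \<and> (\<exists>bs. length bs = length rep_pairs \<and>
        card (del_set bs) \<le> m \<and> free_after \<F> G (del_set bs)))" if "I ?L s'" for s'
    proof -
      have "found ?L \<longleftrightarrow> (sg = NIL \<and> (\<exists>bs. length bs = length rep_pairs \<and>
        card (del_set bs) \<le> m \<and> free_after \<F> G (del_set bs)))"
        unfolding found_def ok_def using bits_val_less by metis
      then show ?thesis using that by (auto simp: I_def state_def)
    qed
  qed (simp add: length_rep_pairs algebra_simps)
qed

lemma length_pairs_vertex_list: "length (lst (pairs (vertex_list (enc_graph G)))) = n * n"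
  by (simp add: lst_pairs lst_vertex_list)

end

text \<open>The time bound does not depend on the budget, which therefore has to be truncated before it
  is passed to a subroutine.\<close>

lemma runs_truncate:
  assumes K: "0 < K" and s: "s 0 = enc_list xs" "s (K + 2) = enc_nat m" "s (K + 3) = NIL"
  shows "runs (While (Var 0) (Seq (Assign 0 (Tl_e (Var 0)))
      (If (Var (K + 2)) (Seq (Assign (K + 2) (Tl_e (Var (K + 2)))) (Assign (K + 3) (Cons_e Nil_e (Var (K + 3)))))
        (Assign (K + 3) (Var (K + 3)))))) s ((length xs + 1) * 14)
    (\<lambda>s'. s' (K + 3) = enc_nat (min m (length xs)) \<and> s' K = s K \<and> s' (K + 1) = s (K + 1))"
proof -
  let ?body = "Seq (Assign 0 (Tl_e (Var 0)))
      (If (Var (K + 2)) (Seq (Assign (K + 2) (Tl_e (Var (K + 2)))) (Assign (K + 3) (Cons_e Nil_e (Var (K + 3)))))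
        (Assign (K + 3) (Var (K + 3))))"
  \<comment> \<open>The list \<open>xs\<close> acts as a clock: whatever the size of
    \<open>m\<close>, at most \<open>length xs\<close> of its cells are removed, and each removed
    cell is rebuilt in \<open>K + 3\<close>.\<close>
  define I where "I i s' \<longleftrightarrow> s' 0 = enc_list (drop i xs) \<and> s' (K + 2) = enc_nat (m - i) \<and>
    s' (K + 3) = enc_nat (min m i) \<and> s' K = s K \<and> s' (K + 1) = s (K + 1)" for i and s' :: store
  have "runs (While (Var 0) ?body) s ((length xs + 1) * (1 + expr_time (Var 0) + 12)) (I (length xs))"
  proof (rule runs_While)
    show "I 0 s" using s by (simp add: I_def)
    show "expr_val (Var 0) s' = NIL" if "I (length xs) s'" for s' using that by (simp add: I_def)
    fix i s' assume i: "i < length xs" and I: "I i s'"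
    have d: "drop i xs = xs ! i # drop (Suc i) xs" using i by (rule Cons_nth_drop_Suc[symmetric])
    have "runs ?body s' ((1 + expr_time (Tl_e (Var 0))) + (1 + expr_time (Var (K + 2)) + 7)) (I (Suc i))"
    proof (intro runs_Seq runs_Assign runs_If)
      let ?s = "s'(0 := expr_val (Tl_e (Var 0)) s')"
      assume "expr_val (Var (K + 2)) ?s \<noteq> NIL"
      then have "i < m" using I K by (simp add: I_def)
      then obtain j where "m - i = Suc j" "m - Suc i = j" "min m (Suc i) = Suc (min m i)"
        by (metis Suc_diff_Suc min.absorb2 Suc_leI less_imp_le)
      then show "runs (Seq (Assign (K + 2) (Tl_e (Var (K + 2)))) (Assign (K + 3) (Cons_e Nil_e (Var (K + 3)))))
          ?s 7 (I (Suc i))"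
        using I K d by (intro runs_le[OF runs_Seq[OF runs_Assign[OF runs_Assign]]]) (auto simp: I_def)
    next
      let ?s = "s'(0 := expr_val (Tl_e (Var 0)) s')"
      assume "expr_val (Var (K + 2)) ?s = NIL"
      then have "enc_nat (m - i) = NIL" using I K by (simp add: I_def)
      then have "m \<le> i" by simp
      then show "runs (Assign (K + 3) (Var (K + 3))) ?s 7 (I (Suc i))"
        using I K d by (intro runs_le[OF runs_Assign]) (auto simp: I_def)
    qed
    moreover have "expr_val (Var 0) s' \<noteq> NIL" using I d by (simp add: I_def)
    ultimately show "expr_val (Var 0) s' \<noteq> NIL \<and> runs ?body s' 12 (I (Suc i))" by simp
  qed
  then show ?thesis by (rule runs_mono) (auto simp: I_def)
qed

section \<open>The complete program and its running time\<close>

lemma polyf_on_next_state: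
  assumes "polyf_on (enc_graph ` input_graphs) dec"
  shows "polyf_on {x. query c x \<in> enc_graph ` input_graphs} (\<lambda>x. next_state c (dec (query c x)) x)"
proof -
  let ?A = "{x. query c x \<in> enc_graph ` input_graphs}"
  have "polyf_on ?A (\<lambda>x. dec (query c x))"
    by (rule polyf_on_comp[OF polyf_on_subset[OF polyf_query] assms]) auto
  then have "polyf_on ?A (\<lambda>x. CONS (dec (query c x)) x)"
    by (intro polyf_CONS polyf_on_id)
  from polyf_comp[OF polyf_next_state[of c] this] show ?thesis by simp
qed

theorem theorem17:
  fixes \<F> :: "'a ecgraph set" and c :: nat
  assumes "\<forall>F\<in>\<F>. c_colored c F"
    and "\<forall>F\<in>\<F>. color_diverse F"
    and "poly_time_decidable enc_graph input_graphs
           {G. \<exists>F\<in>\<F>. contains_induced G F}"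
  shows "\<exists>p a d. decides_in_time p enc_instance (input_graphs \<times> UNIV) (deletion_yes \<F>)
           (\<lambda>(G, k). a * 2 ^ (nbh_diversity G)\<^sup>2 * (card (verts G) + 1) ^ d)"
proof -
  obtain dec where polyf_dec: "polyf_on (enc_graph ` input_graphs) dec"
    and "\<forall>H\<in>input_graphs. dec (enc_graph H) \<noteq> NIL \<longleftrightarrow> H \<in> {G. \<exists>F\<in>\<F>. contains_induced G F}"
    by (rule poly_time_decidable_polyf_on[OF assms(3)])
  then have dec: "\<And>H. H \<in> input_graphs \<Longrightarrow> dec (enc_graph H) \<noteq> NIL \<longleftrightarrow> (\<exists>F\<in>\<F>. contains_induced H F)"
    by simp
  from polyf_onE[OF polyf_on_next_state[OF polyf_dec, of c]] obtain p3 N3 B3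
    where B3: "poly_bounded B3" and p3': "subroutine p3 N3 {x. query c x \<in> enc_graph ` input_graphs}
      (\<lambda>x. next_state c (dec (query c x)) x) B3" by blast
  obtain p1 N1 B1 where B1: "poly_bounded B1" and p1': "subroutine p1 N1 UNIV (\<lambda>g. pairs (vertex_list g)) B1"
    by (rule polyf_onE[OF polyf_comp[OF polyf_pairs polyf_vertex_list[OF polyf_on_id]]])
  obtain p2 N2 B2 where B2: "poly_bounded B2" and p2': "subroutine p2 N2 UNIV first_state B2"
    by (rule polyf_onE[OF polyf_first_state])
  define K where "K = max N1 (max N2 N3)"
  have p1: "subroutine p1 K UNIV (\<lambda>g. pairs (vertex_list g)) B1"
    by (rule subroutine_weaken[OF p1']) (simp add: K_def)
  have p2: "subroutine p2 K UNIV first_state B2"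
    by (rule subroutine_weaken[OF p2']) (simp add: K_def)
  have p3: "subroutine p3 K {x. query c x \<in> enc_graph ` input_graphs}
      (\<lambda>x. next_state c (dec (query c x)) x) B3"
    by (rule subroutine_weaken[OF p3']) (simp add: K_def)
  have K: "0 < K" using p1 by (simp add: subroutine_def)
  let ?trunc = "While (Var 0) (Seq (Assign 0 (Tl_e (Var 0)))
      (If (Var (K + 2)) (Seq (Assign (K + 2) (Tl_e (Var (K + 2)))) (Assign (K + 3) (Cons_e Nil_e (Var (K + 3)))))
        (Assign (K + 3) (Var (K + 3)))))"
  let ?loop = "While (Hd_e (Var 0)) p3"
  \<comment> \<open>Variable \<open>K\<close> holds the graph, \<open>K + 1\<close> the sign,
    \<open>K + 2\<close> the untruncated budget and \<open>K + 3\<close> the truncated one. An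
    assignment takes constant time whatever the size of the tree, so the full budget may be moved
    around freely; only as an argument of a subroutine would its size count.\<close>
  let ?p = "Seq (Assign K (Hd_e (Var 0))) (Seq (Assign (K + 1) (Hd_e (Tl_e (Var 0))))
    (Seq (Assign (K + 2) (Tl_e (Tl_e (Var 0)))) (Seq (Assign 0 (Var K)) (Seq p1
    (Seq (Assign (K + 3) Nil_e) (Seq ?trunc (Seq (Assign 0 (Cons_e (Var (K + 1)) (Cons_e (Var K) (Var (K + 3)))))
    (Seq p2 (Seq ?loop (Assign 0 (Hd_e (Tl_e (Var 0)))))))))))))"
  \<comment> \<open>Bounds in \<open>n\<close>: \<open>W\<close> for the encoded graph and
    \<open>C\<close> for the context handed to the enumeration. The 6 in \<open>C\<close> consists
    of 3 for the sign, 1 for the end of the unary budget and 2 for the pairing cells.\<close>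
  define W where "W n = 1 + n * (n * (2 * (n * n) + 2) + 2)" for n :: nat
  define C where "C n = 6 + (W n + 2 * (n * n))" for n :: nat
  \<comment> \<open>The factor 2 comes from bounding the number of guard evaluations, a power of two
    plus one, by twice that power. The whole running time then is at most the power times
    \<open>P n\<close>.\<close>
  define P where "P n = 40 + (B1 (W n) + ((n * n + 1) * 14 + (B2 (C n) + 2 * (3 + B3 (13 * B2 (C n))))))" for n
  have W: "poly_bounded W" unfolding W_def by (intro poly_bounded_intros)
  have "poly_bounded C" unfolding C_def by (intro poly_bounded_intros W)
  then have BC: "poly_bounded (\<lambda>n. B2 (C n))" by (rule poly_bounded_comp[OF B2])
  have "poly_bounded P" unfolding P_def
    by (intro poly_bounded_add poly_bounded_mult poly_bounded_const poly_bounded_id BC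
        poly_bounded_comp[OF B1 W] poly_bounded_comp[OF B3])
  then obtain a d where P: "\<And>m. P m \<le> a * (m + 1) ^ d" unfolding poly_bounded_def by blast
  have "\<exists>t s. exec ?p (init_store (enc_instance (G, k))) t s \<and>
      t \<le> a * 2 ^ (nbh_diversity G)\<^sup>2 * (card (verts G) + 1) ^ d \<and> (s 0 \<noteq> NIL \<longleftrightarrow> (G, k) \<in> deletion_yes \<F>)"
    if "G \<in> input_graphs" for G k
  proof -
    interpret input_graph G by unfold_locales (rule that)
    let ?g = "enc_graph G"
    define sg where "sg = enc_nat (if k < 0 then 1 else 0)"
    define m where "m = nat \<bar>k\<bar>"
    define m' where "m' = min m (n * n)"
    let ?ctx = "CONS sg (CONS ?g (enc_nat m'))"
    let ?E = "2 ^ (nbh_diversity G)\<^sup>2 :: nat"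
    have inst: "enc_instance (G, k) = CONS ?g (CONS sg (enc_nat m))"
      by (simp add: enc_instance_def enc_int_def sg_def m_def)
    have answer: "sg = NIL \<and> (\<exists>bs. length bs = length rep_pairs \<and> card (del_set bs) \<le> m' \<and>
        free_after \<F> G (del_set bs)) \<longleftrightarrow> (G, k) \<in> deletion_yes \<F>"
      unfolding deletion_yes_iff[OF assms(1,2)] by (auto simp: sg_def m'_def m_def)
    have Wg: "tree_size ?g \<le> W n" using tree_size_enc_graph by (simp add: W_def)
    have "tree_size ?ctx \<le> C n"
      using Wg by (auto simp: C_def sg_def tree_size_enc_nat m'_def)
    then have C: "B2 (tree_size ?ctx) \<le> B2 (C n)" by (rule poly_bounded_monoD[OF B2])
    have "tree_size (first_state ?ctx) \<le> B2 (C n)"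
      using subroutine_size[OF p2, of ?ctx] C by simp
    then have B3C: "B3 (13 * tree_size (first_state ?ctx)) \<le> B3 (13 * B2 (C n))"
      by (intro poly_bounded_monoD[OF B3]) simp
    have B1W: "B1 (tree_size ?g) \<le> B1 (W n)" by (rule poly_bounded_monoD[OF B1 Wg])
    have "runs ?p (init_store (enc_instance (G, k))) (3 + (4 + (4 + (2 + (B1 (W n) + (2 + ((n * n + 1) * 14 +
        (6 + (B2 (C n) + ((?E + 1) * (3 + B3 (13 * B2 (C n))) + 4))))))))))
      (\<lambda>s. s 0 \<noteq> NIL \<longleftrightarrow> (G, k) \<in> deletion_yes \<F>)" (is "runs _ _ _ ?Q")
    proof -
      have loop: "runs (Seq ?loop (Assign 0 (Hd_e (Tl_e (Var 0))))) s ((?E + 1) * (3 + B3 (13 * B2 (C n))) + 4) ?Q"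
        if s: "s 0 = first_state ?ctx" for s
      proof -
        have "runs ?loop s ((?E + 1) * (3 + B3 (13 * B2 (C n))))
            (\<lambda>s'. head (tail (s' 0)) = bool_tree ((G, k) \<in> deletion_yes \<F>))"
          using runs_enumeration[where s = s, OF assms(1) dec B3 p3 s] unfolding answer s
          by (rule runs_le) (assumption, intro mult_le_mono2 add_left_mono B3C)
        then show ?thesis
          by (intro runs_Seq) (erule runs_mono, simp, rule runs_le[OF runs_Assign], auto)
      qed
      have first: "runs (Seq p2 (Seq ?loop (Assign 0 (Hd_e (Tl_e (Var 0)))))) s
          (B2 (C n) + ((?E + 1) * (3 + B3 (13 * B2 (C n))) + 4)) ?Q" if s: "s 0 = ?ctx" for s
        by (rule runs_Seq, rule runs_le[OF _ C], rule subroutine_runs[where s = s, OF p2 s],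
            simp, rule loop)
      have trunc: "runs (Seq ?trunc (Seq (Assign 0 (Cons_e (Var (K + 1)) (Cons_e (Var K) (Var (K + 3)))))
          (Seq p2 (Seq ?loop (Assign 0 (Hd_e (Tl_e (Var 0)))))))) s
          ((n * n + 1) * 14 + (6 + (B2 (C n) + ((?E + 1) * (3 + B3 (13 * B2 (C n))) + 4)))) ?Q"
        if s: "s 0 = pairs (vertex_list ?g)" "s (K + 2) = enc_nat m" "s (K + 3) = NIL" "s K = ?g" "s (K + 1) = sg" for s
      proof (rule runs_Seq, rule runs_mono)
        show "runs ?trunc s ((n * n + 1) * 14)
            (\<lambda>s'. s' (K + 3) = enc_nat m' \<and> s' K = s K \<and> s' (K + 1) = s (K + 1))"
          using runs_truncate[OF K, of s "lst (pairs (vertex_list ?g))" m] s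
          by (simp only: length_pairs_vertex_list enc_list_lst m'_def)
        show "runs (Seq (Assign 0 (Cons_e (Var (K + 1)) (Cons_e (Var K) (Var (K + 3)))))
          (Seq p2 (Seq ?loop (Assign 0 (Hd_e (Tl_e (Var 0))))))) s'
          (6 + (B2 (C n) + ((?E + 1) * (3 + B3 (13 * B2 (C n))) + 4))) ?Q"
          if "s' (K + 3) = enc_nat m' \<and> s' K = s K \<and> s' (K + 1) = s (K + 1)" for s'
          by (rule runs_Seq, rule runs_le[OF runs_Assign], rule first) (use s that in auto)
      qed simp
      have start: "runs (Seq p1 (Seq (Assign (K + 3) Nil_e) (Seq ?trunc (Seq (Assign 0 (Cons_e (Var (K + 1)) (Cons_e (Var K) (Var (K + 3)))))
          (Seq p2 (Seq ?loop (Assign 0 (Hd_e (Tl_e (Var 0)))))))))) s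
          (B1 (W n) + (2 + ((n * n + 1) * 14 + (6 + (B2 (C n) + ((?E + 1) * (3 + B3 (13 * B2 (C n))) + 4)))))) ?Q"
        if s: "s 0 = ?g" "s K = ?g" "s (K + 1) = sg" "s (K + 2) = enc_nat m" for s
        by (rule runs_Seq, rule runs_le[OF _ B1W], rule subroutine_runs[where s = s, OF p1 s(1)], simp,
            rule runs_Seq, rule runs_le[OF runs_Assign], rule trunc)
          (use s K in auto)
      show ?thesis
        by (rule runs_Seq, rule runs_le[OF runs_Assign], rule runs_Seq, rule runs_le[OF runs_Assign],
            rule runs_Seq, rule runs_le[OF runs_Assign], rule runs_Seq, rule runs_le[OF runs_Assign], rule start)
          (use K in \<open>auto simp: inst init_store_def\<close>)
    qed
    moreover have "3 + (4 + (4 + (2 + (B1 (W n) + (2 + ((n * n + 1) * 14 +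
        (6 + (B2 (C n) + ((?E + 1) * (3 + B3 (13 * B2 (C n))) + 4))))))))) \<le> a * ?E * (n + 1) ^ d"
    proof -
      \<comment> \<open>\<open>?X\<close> collects the costs outside the enumeration, which are
        multiplied by \<open>?E\<close> merely to obtain a common factor; \<open>?Y\<close> is the
        cost of one round.\<close>
      let ?X = "40 + (B1 (W n) + ((n * n + 1) * 14 + B2 (C n)))" and ?Y = "3 + B3 (13 * B2 (C n))"
      have E: "1 \<le> ?E" by simp
      have "3 + (4 + (4 + (2 + (B1 (W n) + (2 + ((n * n + 1) * 14 +
          (6 + (B2 (C n) + ((?E + 1) * ?Y + 4))))))))) \<le> ?X + (?E + 1) * ?Y" by simp
      also have "\<dots> \<le> ?E * ?X + (2 * ?E) * ?Y"
        using E by (intro add_mono mult_le_mono1) auto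
      also have "\<dots> = ?E * P n" by (simp add: P_def algebra_simps)
      also have "\<dots> \<le> ?E * (a * (n + 1) ^ d)" by (intro mult_le_mono2 P)
      finally show ?thesis by (simp add: ac_simps)
    qed
    ultimately show ?thesis unfolding runs_def by (meson order_trans)
  qed
  then show ?thesis unfolding decides_in_time_def
    by (intro exI[of _ ?p] exI[of _ a] exI[of _ d]) auto
qed

end
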